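(* Let $T>0$, let $\Omega\subset\mathbb{R}^m$ be compact, let $\Gamma\subset\Omega$ be closed with $\Omega\setminus\Gamma$ open in $\mathbb{R}^m$, let $P:\Omega\setminus\Gamma\to[0,\infty)$ and $\psi:\Omega\to\mathbb{R}$ be Lipschitz continuous. Assume that there exist $a_0,d_0>0$ such that, with $\mathcal{N}=\{x\in\Omega:\ d(x,\Gamma)<a_0\}$, the function $d(\cdot,\Gamma)$ is $C^1$ on $\mathcal{N}\setminus\Gamma$ and $|\nabla d(x,\Gamma)|\ge d_0$ for all $x\in\mathcal{N}\setminus\Gamma$. Assume also that there exists a Lipschitz function $\psi_b:\Omega\to\mathbb{R}$ with $\psi_b=\psi$ on $\Gamma$ such that $(x,t)\mapsto\psi_b(x)$ is a viscosity sub-solution of problem $(\mathcal{P})$ in $\Omega_T$. Then problem $(\mathcal{P})$ admits a unique viscosity solution $f$ in $\Omega_T$, and $f$ is in fact continuous. Moreover, there exists a Lipschitz function $\bar f:\Omega_T\to\mathbb{R}$, with a Lipschitz constant depending on $a_0$, $d_0$, $L_\psi$ and $\|P\|_{L^\infty(\Omega\setminus\Gamma)}$, such that $$\psi_b(x)\le f(x,t)\le \bar f(x,t)\qquad\text{for all }(x,t)\in\Omega_T.$$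
   Context: $|\cdot|$ is the Euclidean norm on $\mathbb{R}^m$; $d(x,\Gamma)=\min_{z\in\Gamma}|x-z|$; $L_h$ is the Lipschitz constant of a Lipschitz function $h$; $\|\cdot\|_{L^\infty(\Sigma)}$ is the supremum norm on $\Sigma$. Set $\Omega_T=\Omega\times[0,T]$ and $\partial\Omega_T=(\Gamma\times(0,T))\cup(\Omega\times\{0\})$. Problem $(\mathcal{P})$ is: $\partial_t f(x,t)=-|\nabla f(x,t)|+P(x)$ for $(x,t)\in(\Omega\setminus\Gamma)\times(0,T)$, and $f(x,t)=\psi(x)$ for $(x,t)\in\partial\Omega_T$. Viscosity solutions. An upper semicontinuous $f:\Omega_T\to\mathbb{R}$ is a viscosity sub-solution of $(\mathcal{P})$ in $(\Omega\setminus\Gamma)\times(0,T)$ if for every $\varphi\in C^1((\Omega\setminus\Gamma)\times(0,T))$ such that $f-\varphi$ has a local maximum at $(x_0,t_0)\in(\Omega\setminus\Gamma)\times(0,T)$ one has $\partial_t\varphi(x_0,t_0)\le-|\nabla\varphi(x_0,t_0)|+P(x_0)$; it is a viscosity sub-solution in $\Omega_T$ if moreover $f(x,t)\le\psi(x)$ for all $(x,t)\in\partial\Omega_T$. A lower semicontinuous $f:\Omega_T\to\mathbb{R}$ is a viscosity super-solution in $(\Omega\setminus\Gamma)\times(0,T)$ if for every such $\varphi$ with $f-\varphi$ having a local minimum at $(x_0,t_0)$ one has $\partial_t\varphi(x_0,t_0)\ge-|\nabla\varphi(x_0,t_0)|+P(x_0)$; it is a viscosity super-solution in $\Omega_T$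 if moreover $f(x,t)\ge\psi(x)$ on $\partial\Omega_T$. A locally bounded $f:\Omega_T\to\mathbb{R}$ is a viscosity solution in $\Omega_T$ if its upper semicontinuous envelope $f^*(x,t)=\limsup_{(y,s)\to(x,t)}f(y,s)$ is a viscosity sub-solution in $\Omega_T$ and its lower semicontinuous envelope $f_*(x,t)=\liminf_{(y,s)\to(x,t)}f(y,s)$ is a viscosity super-solution in $\Omega_T$.
   Formalization: Uniqueness is proved on Ω×[0,T) for all viscosity solutions, and on all of Ω_T only among continuous ones: the definition does not constrain values at t=T, so changing f at one point (x,T) gives another viscosity solution. *)

theory Defs
  imports "HOL-Analysis.Analysis"
begin

text \<open>
  Space-time points are pairs in \<open>'a \<times> real\<close> with the Euclidean product metric. Functions given only
  on a subset (such as \<open>\<psi>\<close> on \<open>\<Omega>\<close> or \<open>P\<close> on \<open>\<Omega> - \<Gamma>\<close>) are total functions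
  whose values outside that subset are never used.
\<close>

definition lip_const :: "'a::metric_space set \<Rightarrow> ('a \<Rightarrow> real) \<Rightarrow> real" where
  "lip_const S h = Inf {L. L-lipschitz_on S h}"

text \<open>The case distinction is there because the supremum of the empty set of reals is unspecified.\<close>

definition sup_norm_on :: "'a set \<Rightarrow> ('a \<Rightarrow> real) \<Rightarrow> real" where
  "sup_norm_on S h = (if S = {} then 0 else (SUP x\<in>S. \<bar>h x\<bar>))"

text \<open>
  \<open>h\<close> is of class \<open>C\<^sup>1\<close> with gradient \<open>G\<close> on the set \<open>U\<close>, which is open in every use below.
  On a space-time set the two components of \<open>G z\<close> are the spatial gradient and the time derivative.
\<close>

definition C1_with_gradient_on :: "'a::real_inner set \<Rightarrow> ('a \<Rightarrow> real) \<Rightarrow> ('a \<Rightarrow> 'a) \<Rightarrow> bool" where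
  "C1_with_gradient_on U h G \<longleftrightarrow> (\<forall>z\<in>U. GDERIV h z :> G z) \<and> continuous_on U G"

definition usc_on :: "'a::topological_space set \<Rightarrow> ('a \<Rightarrow> real) \<Rightarrow> bool" where
  "usc_on S f \<longleftrightarrow> (\<forall>z\<in>S. \<forall>a. f z < a \<longrightarrow> (\<forall>\<^sub>F w in at z within S. f w < a))"

definition lsc_on :: "'a::topological_space set \<Rightarrow> ('a \<Rightarrow> real) \<Rightarrow> bool" where
  "lsc_on S f \<longleftrightarrow> (\<forall>z\<in>S. \<forall>a. a < f z \<longrightarrow> (\<forall>\<^sub>F w in at z within S. a < f w))"

definition locally_bounded_on :: "'a::metric_space set \<Rightarrow> ('a \<Rightarrow> real) \<Rightarrow> bool" where
  "locally_bounded_on S f \<longleftrightarrow> (\<forall>z\<in>S. \<exists>e>0. bounded (f ` (ball z e \<inter> S)))"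

text \<open>
  Semicontinuous envelopes relative to \<open>S\<close>. The filter \<open>inf (nhds z) (principal S)\<close> is used rather
  than \<open>at z within S\<close>, because in an envelope the limit superior includes the value at \<open>z\<close> itself.
  The extended real limits are finite for locally bounded \<open>f\<close> and \<open>z \<in> S\<close>.
\<close>

definition usc_envelope :: "'a::topological_space set \<Rightarrow> ('a \<Rightarrow> real) \<Rightarrow> 'a \<Rightarrow> real" where
  "usc_envelope S f z = real_of_ereal (Limsup (inf (nhds z) (principal S)) (\<lambda>w. ereal (f w)))"

definition lsc_envelope :: "'a::topological_space set \<Rightarrow> ('a \<Rightarrow> real) \<Rightarrow> 'a \<Rightarrow> real" where
  "lsc_envelope S f z = real_of_ereal (Liminf (inf (nhds z) (principal S)) (\<lambda>w. ereal (f w)))"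

definition local_max_on :: "'a::topological_space set \<Rightarrow> ('a \<Rightarrow> real) \<Rightarrow> 'a \<Rightarrow> bool" where
  "local_max_on U h z \<longleftrightarrow> z \<in> U \<and> (\<forall>\<^sub>F w in at z within U. h w \<le> h z)"

definition local_min_on :: "'a::topological_space set \<Rightarrow> ('a \<Rightarrow> real) \<Rightarrow> 'a \<Rightarrow> bool" where
  "local_min_on U h z \<longleftrightarrow> z \<in> U \<and> (\<forall>\<^sub>F w in at z within U. h z \<le> h w)"

text \<open>The set written \<open>\<partial>\<Omega>\<^sub>T\<close>; it contains no point of \<open>\<Gamma> \<times> {T}\<close>.\<close>

definition parabolic_boundary :: "'a set \<Rightarrow> 'a set \<Rightarrow> real \<Rightarrow> ('a \<times> real) set" where
  "parabolic_boundary \<Omega> \<Gamma> T = \<Gamma> \<times> {0<..<T} \<union> \<Omega> \<times> {0}"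

definition visc_subsolution_interior ::
  "'a::euclidean_space set \<Rightarrow> 'a set \<Rightarrow> real \<Rightarrow> ('a \<Rightarrow> real) \<Rightarrow> ('a \<times> real \<Rightarrow> real) \<Rightarrow> bool" where
  "visc_subsolution_interior \<Omega> \<Gamma> T P f \<longleftrightarrow>
     usc_on (\<Omega> \<times> {0..T}) f \<and>
     (let U = (\<Omega> - \<Gamma>) \<times> {0<..<T} in
      \<forall>\<phi> G x t. C1_with_gradient_on U \<phi> G \<longrightarrow>
        local_max_on U (\<lambda>z. f z - \<phi> z) (x, t) \<longrightarrow>
        snd (G (x, t)) \<le> - norm (fst (G (x, t))) + P x)"

definition visc_supersolution_interior ::
  "'a::euclidean_space set \<Rightarrow> 'a set \<Rightarrow> real \<Rightarrow> ('a \<Rightarrow> real) \<Rightarrow> ('a \<times> real \<Rightarrow> real) \<Rightarrow> bool" where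
  "visc_supersolution_interior \<Omega> \<Gamma> T P f \<longleftrightarrow>
     lsc_on (\<Omega> \<times> {0..T}) f \<and>
     (let U = (\<Omega> - \<Gamma>) \<times> {0<..<T} in
      \<forall>\<phi> G x t. C1_with_gradient_on U \<phi> G \<longrightarrow>
        local_min_on U (\<lambda>z. f z - \<phi> z) (x, t) \<longrightarrow>
        snd (G (x, t)) \<ge> - norm (fst (G (x, t))) + P x)"

definition visc_subsolution ::
  "'a::euclidean_space set \<Rightarrow> 'a set \<Rightarrow> real \<Rightarrow> ('a \<Rightarrow> real) \<Rightarrow> ('a \<Rightarrow> real) \<Rightarrow>
    ('a \<times> real \<Rightarrow> real) \<Rightarrow> bool" where
  "visc_subsolution \<Omega> \<Gamma> T P \<psi> f \<longleftrightarrow>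
     visc_subsolution_interior \<Omega> \<Gamma> T P f \<and>
     (\<forall>(x, t)\<in>parabolic_boundary \<Omega> \<Gamma> T. f (x, t) \<le> \<psi> x)"

definition visc_supersolution ::
  "'a::euclidean_space set \<Rightarrow> 'a set \<Rightarrow> real \<Rightarrow> ('a \<Rightarrow> real) \<Rightarrow> ('a \<Rightarrow> real) \<Rightarrow>
    ('a \<times> real \<Rightarrow> real) \<Rightarrow> bool" where
  "visc_supersolution \<Omega> \<Gamma> T P \<psi> f \<longleftrightarrow>
     visc_supersolution_interior \<Omega> \<Gamma> T P f \<and>
     (\<forall>(x, t)\<in>parabolic_boundary \<Omega> \<Gamma> T. f (x, t) \<ge> \<psi> x)"

definition visc_solution ::
  "'a::euclidean_space set \<Rightarrow> 'a set \<Rightarrow> real \<Rightarrow> ('a \<Rightarrow> real) \<Rightarrow> ('a \<Rightarrow> real) \<Rightarrow>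
    ('a \<times> real \<Rightarrow> real) \<Rightarrow> bool" where
  "visc_solution \<Omega> \<Gamma> T P \<psi> f \<longleftrightarrow>
     locally_bounded_on (\<Omega> \<times> {0..T}) f \<and>
     visc_subsolution \<Omega> \<Gamma> T P \<psi> (usc_envelope (\<Omega> \<times> {0..T}) f) \<and>
     visc_supersolution \<Omega> \<Gamma> T P \<psi> (lsc_envelope (\<Omega> \<times> {0..T}) f)"

end

theory Submission
  imports Defs
begin

text \<open>
  The equation \<open>\<partial>\<^sub>t f = - |\<nabla>f| + P\<close> is the dynamic programming equation of a traveller of speed at most
  one who pays \<open>P\<close> per unit of time and, on arrival at \<open>\<Gamma>\<close> or when the clock runs out, the terminal
  cost \<open>\<psi>\<close>. The explicit barriers below come from this picture, while existence is obtained by Perron's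
  method, so that no trajectory ever has to be integrated.

  Comparison (\<open>visc_comparison\<close>). Let \<open>u\<close> be a sub-solution and \<open>v\<close> a super-solution, with
  \<open>u \<le> v\<close> on the parabolic boundary. If \<open>u > v\<close> somewhere before time \<open>T\<close>, maximise
  \<open>u z - v w - n |z - w|\<^sup>2 - l / (T - t)\<close>, where \<open>t\<close> is the time of \<open>z\<close>. For large \<open>n\<close> the maximisers
  \<open>z\<close> and \<open>w\<close> are interior and close to each other. Both test functions have the spatial gradient
  \<open>2 n (x - y)\<close>, with \<open>x\<close> and \<open>y\<close> the places of \<open>z\<close> and \<open>w\<close>, so the gradient terms cancel and \<open>l / T\<^sup>2 \<le> P x - P y\<close> is left, which is
  impossible in the limit. The conclusion is restricted to times before \<open>T\<close> because sub- and
  super-solutions are only tested there.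

  Upper barriers. Going straight from \<open>x\<close> to \<open>y \<in> \<Gamma>\<close> costs at most \<open>C |x - y| + \<psi> y\<close> if \<open>P \<le> C\<close>. The
  infimum over \<open>y\<close> is \<open>lip_upper_extension \<Gamma> \<psi> C\<close>, a super-solution. If \<open>C\<close> is moreover a Lipschitz
  constant of \<open>\<psi>\<close>, it equals \<open>\<psi>\<close> on \<open>\<Gamma>\<close> and is at least \<open>\<psi>\<close> elsewhere. It is the Lipschitz majorant of
  the theorem, and its Lipschitz constant \<open>C\<close>, the maximum of those two bounds, is the same for all
  \<open>T\<close>. Staying put gives the super-solution \<open>\<psi> x + M t\<close>, where \<open>P \<le> M\<close>; it has the right initial
  values. The minimum of the two equals \<open>\<psi>\<close> on the whole parabolic boundary.

  Lower barriers. \<open>\<psi>\<^sub>b\<close> has the right values on \<open>\<Gamma>\<close>, and \<open>\<psi> x - l t\<close>, with \<open>l\<close> a Lipschitz constant of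
  \<open>\<psi>\<close>, has the right initial values, so their maximum equals \<open>\<psi>\<close> on the parabolic boundary.

  Existence (\<open>visc_perron\<close>). The largest sub-solution \<open>F\<close> between these barriers is upper
  semicontinuous, since the upper envelope of a supremum of sub-solutions is a sub-solution. Its
  lower envelope \<open>E\<close> is a super-solution, since a violation would permit raising \<open>F\<close> locally.
  As \<open>F \<le> E\<close> on the parabolic boundary, comparison gives \<open>F = E\<close>, that is, continuity, before the
  final time.

  The final time. To obtain continuity up to \<open>T\<close>, the problem is solved on a longer time
  interval and the solution restricted. Every test function on the short interval has to be
  replaced by one on the long interval, which is done by precomposing with a clock that
  never reaches \<open>T\<close> (\<open>saturating_clock\<close>).
\<close>

section \<open>Semicontinuous functions and their envelopes\<close>

text \<open>Over the full neighbourhood filter instead of the punctured one: then semicontinuity can be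
  combined with other facts that hold near a point, and the point itself needs no special case.\<close>

lemma usc_on_iff_nhds:
  "usc_on S f \<longleftrightarrow> (\<forall>z\<in>S. \<forall>a>f z. \<forall>\<^sub>F w in nhds z. w \<in> S \<longrightarrow> f w < a)"
  unfolding usc_on_def eventually_at_filter
  by (intro ball_cong refl all_cong1 imp_cong) (auto elim: eventually_mono)

lemma lsc_on_iff_usc_on_uminus: "lsc_on S f \<longleftrightarrow> usc_on S (\<lambda>z. - f z)"
proof -
  have "(\<forall>a. a < f z \<longrightarrow> Q a) \<longleftrightarrow> (\<forall>a. - f z < a \<longrightarrow> Q (- a))" for z and Q :: "real \<Rightarrow> bool"
    by (metis add.inverse_inverse neg_less_iff_less)
  then show ?thesis
    unfolding usc_on_def lsc_on_def by (simp add: minus_less_iff)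
qed

lemma lsc_on_iff_nhds:
  "lsc_on S f \<longleftrightarrow> (\<forall>z\<in>S. \<forall>a<f z. \<forall>\<^sub>F w in nhds z. w \<in> S \<longrightarrow> a < f w)"
  unfolding lsc_on_def eventually_at_filter
  by (intro ball_cong refl all_cong1 imp_cong) (auto elim: eventually_mono)

lemma continuous_on_iff_usc_lsc: "continuous_on S f \<longleftrightarrow> usc_on S f \<and> lsc_on S f"
  unfolding continuous_on_def order_tendsto_iff usc_on_def lsc_on_def by blast

lemma usc_on_subset: "usc_on S f \<Longrightarrow> A \<subseteq> S \<Longrightarrow> usc_on A f"
  unfolding usc_on_iff_nhds by (blast intro: eventually_mono)

lemma lsc_on_subset: "lsc_on S f \<Longrightarrow> A \<subseteq> S \<Longrightarrow> lsc_on A f"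
  unfolding lsc_on_iff_usc_on_uminus by (rule usc_on_subset)

lemma usc_on_cong: "(\<And>z. z \<in> S \<Longrightarrow> f z = g z) \<Longrightarrow> usc_on S f \<longleftrightarrow> usc_on S g"
  unfolding usc_on_iff_nhds by simp

lemma lsc_on_cong: "(\<And>z. z \<in> S \<Longrightarrow> f z = g z) \<Longrightarrow> lsc_on S f \<longleftrightarrow> lsc_on S g"
  unfolding lsc_on_iff_nhds by simp

lemma usc_on_add:
  fixes f g :: "'a::topological_space \<Rightarrow> real"
  assumes "usc_on S f" "usc_on S g"
  shows "usc_on S (\<lambda>z. f z + g z)"
  unfolding usc_on_iff_nhds
proof (intro ballI allI impI)
  fix z a assume z: "z \<in> S" and a: "f z + g z < a"
  define e where "e = (a - f z - g z) / 2"
  have "e > 0" using a by (simp add: e_def)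
  then have "\<forall>\<^sub>F w in nhds z. w \<in> S \<longrightarrow> f w < f z + e" "\<forall>\<^sub>F w in nhds z. w \<in> S \<longrightarrow> g w < g z + e"
    using assms z unfolding usc_on_iff_nhds by simp_all
  then show "\<forall>\<^sub>F w in nhds z. w \<in> S \<longrightarrow> f w + g w < a"
    by eventually_elim (auto simp: e_def field_simps)
qed

lemma usc_on_compose:
  assumes "usc_on S f" "continuous_on A p" "p ` A \<subseteq> S"
  shows "usc_on A (\<lambda>z. f (p z))"
  unfolding usc_on_def
proof (intro ballI allI impI)
  fix z a assume z: "z \<in> A" and a: "f (p z) < a"
  have "\<forall>\<^sub>F w in nhds (p z). w \<in> S \<longrightarrow> f w < a"
    using assms(1,3) z a unfolding usc_on_iff_nhds by blast
  moreover have "filterlim p (nhds (p z)) (at z within A)"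
    using assms(2) z by (auto simp: continuous_on_def)
  ultimately have "\<forall>\<^sub>F w in at z within A. p w \<in> S \<longrightarrow> f (p w) < a"
    unfolding filterlim_iff by blast
  moreover have "\<forall>\<^sub>F w in at z within A. w \<in> A" by (simp add: eventually_at_filter)
  ultimately show "\<forall>\<^sub>F w in at z within A. f (p w) < a"
    by eventually_elim (use assms(3) in blast)
qed

lemma usc_on_max:
  fixes f g :: "'a::topological_space \<Rightarrow> real"
  assumes "usc_on S f" "usc_on S g"
  shows "usc_on S (\<lambda>z. max (f z) (g z))"
  using assms unfolding usc_on_def by (auto intro: eventually_conj)

text \<open>If no maximum is attained, the sets on which \<open>f\<close> stays below a value of \<open>f\<close> cover \<open>S\<close>, and the
  largest value belonging to a finite subcover is smaller than itself.\<close>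

lemma usc_on_attains_max:
  fixes f :: "'a::topological_space \<Rightarrow> real"
  assumes "compact S" "S \<noteq> {}" "usc_on S f"
  obtains z where "z \<in> S" "\<And>w. w \<in> S \<Longrightarrow> f w \<le> f z"
proof -
  have "\<exists>z\<in>S. \<forall>w\<in>S. f w \<le> f z"
  proof (rule ccontr)
    assume "\<not> ?thesis"
    then have above: "\<forall>z\<in>S. \<exists>w\<in>S. f z < f w" by (auto simp: not_le)
    have "\<forall>z\<in>S. \<exists>V. open V \<and> z \<in> V \<and> (\<exists>y\<in>S. \<forall>w\<in>V \<inter> S. f w < f y)"
    proof
      fix z assume z: "z \<in> S"
      then obtain y where "y \<in> S" "f z < f y" using above by blast
      then have "\<forall>\<^sub>F w in nhds z. w \<in> S \<longrightarrow> f w < f y"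
        using assms(3) z unfolding usc_on_iff_nhds by blast
      then show "\<exists>V. open V \<and> z \<in> V \<and> (\<exists>y\<in>S. \<forall>w\<in>V \<inter> S. f w < f y)"
        using \<open>y \<in> S\<close> unfolding eventually_nhds by blast
    qed
    then obtain V where V: "\<And>z. z \<in> S \<Longrightarrow> open (V z) \<and> z \<in> V z \<and> (\<exists>y\<in>S. \<forall>w\<in>V z \<inter> S. f w < f y)"
      by metis
    then obtain y where y: "\<And>z. z \<in> S \<Longrightarrow> y z \<in> S \<and> (\<forall>w\<in>V z \<inter> S. f w < f (y z))"
      by metis
    obtain C where C: "C \<subseteq> S" "finite C" "S \<subseteq> (\<Union>z\<in>C. V z)"
      using compactE_image[OF assms(1), of S V] V by blast
    have "C \<noteq> {}" using C assms(2) by auto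
    have "Max ((f \<circ> y) ` C) \<in> (f \<circ> y) ` C" using \<open>C \<noteq> {}\<close> C(2) by (intro Max_in) auto
    then obtain c where c: "c \<in> C" "f (y c) = Max ((f \<circ> y) ` C)" by auto
    have "y c \<in> S" using c C y by blast
    then obtain b where b: "b \<in> C" "y c \<in> V b" using C by blast
    then have "f (y c) < f (y b)" using y C \<open>y c \<in> S\<close> by blast
    moreover have "f (y b) \<le> f (y c)" using c b C by simp
    ultimately show False by simp
  qed
  then show ?thesis using that by blast
qed

lemma lsc_envelope_eq_uminus:
  "lsc_envelope S f z = - usc_envelope S (\<lambda>w. - f w) z"
proof -
  have "Limsup F (\<lambda>w. ereal (- f w)) = - Liminf F (\<lambda>w. ereal (f w))" for F :: "'a filter"
    using ereal_Limsup_uminus[of F "\<lambda>w. ereal (f w)"] by simp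
  then show ?thesis unfolding usc_envelope_def lsc_envelope_def
    by simp
qed

lemma locally_bounded_on_uminus: "locally_bounded_on S f \<Longrightarrow> locally_bounded_on S (\<lambda>w. - f w)"
  unfolding locally_bounded_on_def by (simp add: bounded_iff)

lemma locally_bounded_on_bounded: "bounded (f ` S) \<Longrightarrow> locally_bounded_on S f"
  unfolding locally_bounded_on_def by (meson bounded_subset image_mono inf_le2 zero_less_one)

text \<open>Local boundedness makes the extended real limits finite, so that within the following context the
  conversion back to the reals loses nothing.\<close>

context
  fixes S :: "'a::metric_space set" and f :: "'a \<Rightarrow> real"
  assumes lb: "locally_bounded_on S f"
begin

lemma ereal_usc_envelope:
  assumes "z \<in> S"
  shows "ereal (usc_envelope S f z) = Limsup (inf (nhds z) (principal S)) (\<lambda>w. ereal (f w))"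
proof -
  let ?F = "inf (nhds z) (principal S)"
  have nt: "?F \<noteq> bot"
    using assms unfolding trivial_limit_def eventually_inf_principal
    by (metis eventually_nhds_x_imp_x)
  obtain e where e: "e > 0" "bounded (f ` (ball z e \<inter> S))"
    using lb assms unfolding locally_bounded_on_def by blast
  then obtain B where "\<forall>y\<in>f ` (ball z e \<inter> S). norm y \<le> B" unfolding bounded_iff by blast
  then have B: "\<bar>f w\<bar> \<le> B" if "w \<in> ball z e \<inter> S" for w using that by force
  have "\<forall>\<^sub>F w in nhds z. w \<in> ball z e" using e by (intro eventually_nhds_in_open) auto
  then have ev: "\<forall>\<^sub>F w in ?F. \<bar>f w\<bar> \<le> B"
    unfolding eventually_inf_principal by eventually_elim (use B in auto)
  have "Limsup ?F (\<lambda>w. ereal (f w)) \<le> ereal B"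
    by (rule Limsup_bounded) (use ev in eventually_elim, auto)
  moreover have "ereal (- B) \<le> Liminf ?F (\<lambda>w. ereal (f w))"
    by (rule Liminf_bounded) (use ev in eventually_elim, auto)
  then have "ereal (- B) \<le> Limsup ?F (\<lambda>w. ereal (f w))"
    using Liminf_le_Limsup[OF nt] order_trans by blast
  ultimately have "\<bar>Limsup ?F (\<lambda>w. ereal (f w))\<bar> \<noteq> \<infinity>"
    by (cases "Limsup ?F (\<lambda>w. ereal (f w))") auto
  then show ?thesis unfolding usc_envelope_def by (simp add: ereal_real')
qed

lemma usc_envelope_less_imp_eventually:
  assumes "z \<in> S" "usc_envelope S f z < a"
  shows "\<forall>\<^sub>F w in nhds z. w \<in> S \<longrightarrow> f w < a"
proof -
  have "Limsup (inf (nhds z) (principal S)) (\<lambda>w. ereal (f w)) < ereal a"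
    using ereal_usc_envelope[OF assms(1)] assms(2) by (metis ereal_less_eq(3) linorder_not_le)
  then have "\<forall>\<^sub>F w in inf (nhds z) (principal S). ereal (f w) < ereal a"
    by (rule Limsup_lessD)
  then show ?thesis by (simp add: eventually_inf_principal)
qed

lemma usc_envelope_leI:
  assumes "z \<in> S" "\<forall>\<^sub>F w in nhds z. w \<in> S \<longrightarrow> f w \<le> a"
  shows "usc_envelope S f z \<le> a"
proof -
  have "Limsup (inf (nhds z) (principal S)) (\<lambda>w. ereal (f w)) \<le> ereal a"
    by (rule Limsup_bounded) (use assms in \<open>simp add: eventually_inf_principal\<close>)
  then show ?thesis using ereal_usc_envelope[OF assms(1)] by (metis ereal_less_eq(3))
qed

lemma le_usc_envelope: "z \<in> S \<Longrightarrow> f z \<le> usc_envelope S f z"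
  using usc_envelope_less_imp_eventually eventually_nhds_x_imp_x
  by (metis linorder_not_le order_less_irrefl)

lemma usc_on_usc_envelope: "usc_on S (usc_envelope S f)"
  unfolding usc_on_iff_nhds
proof (intro ballI allI impI)
  fix z a assume z: "z \<in> S" and a: "usc_envelope S f z < a"
  obtain b where b: "usc_envelope S f z < b" "b < a" using a dense by blast
  have "\<forall>\<^sub>F y in nhds z. \<forall>\<^sub>F w in nhds y. w \<in> S \<longrightarrow> f w < b"
    using usc_envelope_less_imp_eventually[OF z b(1)] by (simp add: eventually_eventually)
  then show "\<forall>\<^sub>F w in nhds z. w \<in> S \<longrightarrow> usc_envelope S f w < a"
  proof eventually_elim
    case (elim y)
    have "usc_envelope S f y \<le> b" if "y \<in> S"
      by (rule usc_envelope_leI[OF that]) (use elim in eventually_elim, auto)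
    then show ?case using b by auto
  qed
qed

text \<open>The upper envelope is the least upper semicontinuous majorant.\<close>

lemma usc_envelope_le_usc:
  assumes "usc_on S g" "\<And>w. w \<in> S \<Longrightarrow> f w \<le> g w" "z \<in> S"
  shows "usc_envelope S f z \<le> g z"
proof (rule field_le_epsilon)
  fix e :: real assume "e > 0"
  then have "\<forall>\<^sub>F w in nhds z. w \<in> S \<longrightarrow> g w < g z + e"
    using assms unfolding usc_on_iff_nhds by simp
  then show "usc_envelope S f z \<le> g z + e"
    by (intro usc_envelope_leI[OF assms(3)], eventually_elim) (use assms(2) in force)
qed

end

lemma lsc_envelope_le:
  "locally_bounded_on S f \<Longrightarrow> z \<in> S \<Longrightarrow> lsc_envelope S f z \<le> f z"
  using le_usc_envelope[OF locally_bounded_on_uminus] unfolding lsc_envelope_eq_uminus by fastforce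

lemma lsc_on_lsc_envelope: "locally_bounded_on S f \<Longrightarrow> lsc_on S (lsc_envelope S f)"
  using usc_on_usc_envelope[OF locally_bounded_on_uminus, of S f]
  unfolding lsc_on_iff_usc_on_uminus lsc_envelope_eq_uminus by simp

lemma lsc_le_lsc_envelope:
  assumes "locally_bounded_on S f" "lsc_on S g" "\<And>w. w \<in> S \<Longrightarrow> g w \<le> f w" "z \<in> S"
  shows "g z \<le> lsc_envelope S f z"
  using usc_envelope_le_usc[OF locally_bounded_on_uminus[OF assms(1)], of "\<lambda>w. - g w" z] assms(2-4)
  unfolding lsc_on_iff_usc_on_uminus lsc_envelope_eq_uminus by simp

lemma usc_envelope_eq_of_usc:
  "locally_bounded_on S f \<Longrightarrow> usc_on S f \<Longrightarrow> z \<in> S \<Longrightarrow> usc_envelope S f z = f z"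
  by (intro antisym usc_envelope_le_usc le_usc_envelope) auto

lemma lsc_envelope_eq_of_lsc:
  "locally_bounded_on S f \<Longrightarrow> lsc_on S f \<Longrightarrow> z \<in> S \<Longrightarrow> lsc_envelope S f z = f z"
  by (intro antisym lsc_le_lsc_envelope lsc_envelope_le) auto

section \<open>Gradients and changes of time in test functions\<close>

lemma C1_with_gradient_onD:
  assumes "C1_with_gradient_on U \<phi> G" "z \<in> U"
  shows "(\<phi> has_derivative (\<lambda>h. inner h (G z))) (at z)"
  using assms unfolding C1_with_gradient_on_def gderiv_def by blast

lemma local_max_on_iff_nhds:
  "local_max_on U h z \<longleftrightarrow> z \<in> U \<and> (\<forall>\<^sub>F w in nhds z. w \<in> U \<longrightarrow> h w \<le> h z)"
  unfolding local_max_on_def eventually_at_filter by (auto elim: eventually_mono)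

lemma local_min_on_iff_nhds:
  "local_min_on U h z \<longleftrightarrow> z \<in> U \<and> (\<forall>\<^sub>F w in nhds z. w \<in> U \<longrightarrow> h z \<le> h w)"
  unfolding local_min_on_def eventually_at_filter by (auto elim: eventually_mono)

text \<open>Comparing two test functions that touch at a point is how an inequality known classically for
  one of them carries over to the other.\<close>

lemma gradient_eq_of_local_max:
  assumes "GDERIV g z :> a" "GDERIV h z :> b" "\<forall>\<^sub>F w in nhds z. g w - h w \<le> g z - h z"
  shows "a = b"
proof -
  have "GDERIV (\<lambda>w. g w - h w) z :> a - b" using assms by (intro GDERIV_diff)
  moreover have "\<forall>\<^sub>F w in at z. g w - h w \<le> g z - h z"
    using assms(3) by (auto simp: eventually_at_filter elim: eventually_mono)
  ultimately have "(\<lambda>k. inner k (a - b)) = (\<lambda>k. 0)"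
    unfolding gderiv_def by (rule has_derivative_local_max)
  then have "inner (a - b) (a - b) = 0" by metis
  then show ?thesis by simp
qed

lemma GDERIV_snd: "GDERIV (\<lambda>z::'a::real_inner \<times> real. snd z) z :> (0, 1)"
  unfolding gderiv_def by (auto intro!: derivative_eq_intros simp: inner_prod_def)

lemma GDERIV_quadratic:
  "GDERIV (\<lambda>z::'a::real_inner. c * inner (z - w) (z - w)) z :> (2 * c) *\<^sub>R (z - w)"
  unfolding gderiv_def
  by (rule derivative_eq_intros refl)+ (auto simp: inner_commute algebra_simps)

lemma C1_with_gradient_on_quadratic:
  "C1_with_gradient_on U (\<lambda>z. c * inner (z - w) (z - w)) (\<lambda>z. (2 * c) *\<^sub>R (z - w))"
  unfolding C1_with_gradient_on_def by (auto intro!: GDERIV_quadratic continuous_intros)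

lemma C1_with_gradient_on_add:
  assumes "C1_with_gradient_on U \<phi> G" "C1_with_gradient_on U \<psi> H"
  shows "C1_with_gradient_on U (\<lambda>z. \<phi> z + \<psi> z) (\<lambda>z. G z + H z)"
  using assms unfolding C1_with_gradient_on_def by (auto intro!: GDERIV_add continuous_intros)

text \<open>Test functions have to be defined on a whole time interval. Reparametrising time moves them from
  one interval to another.\<close>

lemma C1_with_gradient_on_time_change:
  fixes \<phi> :: "'a::real_inner \<times> real \<Rightarrow> real"
  assumes \<phi>: "C1_with_gradient_on (D \<times> {0<..<T}) \<phi> G"
    and \<theta>: "\<And>t. t \<in> {0<..<T'} \<Longrightarrow> \<theta> t \<in> {0<..<T} \<and> (\<theta> has_real_derivative \<theta>' t) (at t)"
    and cont: "continuous_on {0<..<T'} \<theta>'"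
  shows "C1_with_gradient_on (D \<times> {0<..<T'}) (\<lambda>z. \<phi> (fst z, \<theta> (snd z)))
    (\<lambda>z. (fst (G (fst z, \<theta> (snd z))), \<theta>' (snd z) * snd (G (fst z, \<theta> (snd z)))))"
  unfolding C1_with_gradient_on_def
proof
  have c\<theta>: "continuous_on {0<..<T'} \<theta>"
    by (metis \<theta> DERIV_continuous_on has_field_derivative_at_within)
  have cG: "continuous_on (D \<times> {0<..<T}) G"
    using \<phi> unfolding C1_with_gradient_on_def by simp
  have c1: "continuous_on (D \<times> {0<..<T'}) (\<lambda>z. \<theta> (snd z))"
    by (rule continuous_on_compose2[OF c\<theta>]) (auto intro!: continuous_intros)
  have c2: "continuous_on (D \<times> {0<..<T'}) (\<lambda>z. \<theta>' (snd z))"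
    by (rule continuous_on_compose2[OF cont]) (auto intro!: continuous_intros)
  have c3: "continuous_on (D \<times> {0<..<T'}) (\<lambda>z. G (fst z, \<theta> (snd z)))"
    by (rule continuous_on_compose2[OF cG]) (use \<theta> in \<open>auto intro!: continuous_intros c1\<close>)
  show "continuous_on (D \<times> {0<..<T'})
     (\<lambda>z. (fst (G (fst z, \<theta> (snd z))), \<theta>' (snd z) * snd (G (fst z, \<theta> (snd z)))))"
    by (intro continuous_intros c2 c3)
  show "\<forall>z\<in>D \<times> {0<..<T'}. GDERIV (\<lambda>z. \<phi> (fst z, \<theta> (snd z))) z
     :> (fst (G (fst z, \<theta> (snd z))), \<theta>' (snd z) * snd (G (fst z, \<theta> (snd z))))"
  proof
    fix z :: "'a \<times> real" assume z: "z \<in> D \<times> {0<..<T'}"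
    let ?p = "(fst z, \<theta> (snd z))"
    have p: "?p \<in> D \<times> {0<..<T}" using z \<theta> by auto
    have s: "snd z \<in> {0<..<T'}" using z by auto
    have d\<theta>: "(\<theta> has_derivative (\<lambda>h. \<theta>' (snd z) * h)) (at (snd z))"
      using \<theta>[OF s] by (auto simp: has_field_derivative_def)
    have "((\<lambda>z. \<theta> (snd z)) has_derivative (\<lambda>h. \<theta>' (snd z) * snd h)) (at z)"
      by (rule has_derivative_compose[of snd snd, OF _ d\<theta>]) (auto intro!: derivative_eq_intros)
    then have "((\<lambda>z. (fst z, \<theta> (snd z))) has_derivative (\<lambda>h. (fst h, \<theta>' (snd z) * snd h))) (at z)"
      by (auto intro!: derivative_eq_intros)
    from has_derivative_compose[OF this C1_with_gradient_onD[OF \<phi> p]]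
    show "GDERIV (\<lambda>z. \<phi> (fst z, \<theta> (snd z))) z
       :> (fst (G ?p), \<theta>' (snd z) * snd (G ?p))"
      unfolding gderiv_def by (rule has_derivative_subst) (auto simp: inner_prod_def algebra_simps)
  qed
qed

text \<open>A \<open>C\<^sup>1\<close> clock that shows the true time up to \<open>s\<close> and then slows down so as never to reach \<open>T\<close>. With
  it a test function on \<open>(0,T)\<close> becomes one on \<open>(0,T')\<close> without any change near a given earlier time.\<close>

lemma saturating_clock:
  fixes s T T' :: real
  assumes "0 < s" "s < T"
  obtains \<theta> \<theta>' where
    "\<And>t. t \<in> {0<..<T'} \<Longrightarrow> \<theta> t \<in> {0<..<T} \<and> (\<theta> has_real_derivative \<theta>' t) (at t)"
    "continuous_on {0<..<T'} \<theta>'"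
    "\<And>t. t \<le> s \<Longrightarrow> \<theta> t = t" "\<And>t. t \<le> s \<Longrightarrow> \<theta>' t = 1"
proof -
  define r where "r = T - s"
  have r: "r > 0" using assms by (simp add: r_def)
  \<comment> \<open>the Moebius map that fixes \<open>s\<close> with slope one and tends to \<open>s + r = T\<close>\<close>
  define f where "f t = s + (t - s) * r / (t - s + r)" for t
  define f' where "f' t = r\<^sup>2 / (t - s + r)\<^sup>2" for t
  define \<theta> where "\<theta> t = (if t \<in> {..s} then t else f t)" for t
  define \<theta>' where "\<theta>' t = (if t \<in> {..s} then 1 else f' t)" for t
  have df: "(f has_real_derivative f' t) (at t)" if "t \<ge> s" for t
    unfolding f_def f'_def
    using that r by (auto intro!: derivative_eq_intros simp: power2_eq_square field_simps)
  have d: "(\<theta> has_real_derivative \<theta>' t) (at t)" for t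
  proof -
    have "((\<lambda>t. if t \<in> {..s} then t else f t) has_derivative
          (if t \<in> {..s} then (\<lambda>h. h * 1) else (\<lambda>h. h * f' t))) (at t within {..s} \<union> {s..})"
      apply (rule has_derivative_If_within_closures)
      subgoal by (auto intro!: derivative_eq_intros)
      subgoal using df[of t, THEN has_field_derivative_at_within]
        by (auto simp: has_field_derivative_def mult_commute_abs)
      subgoal using r by (auto simp: f_def)
      subgoal using r by (auto simp: f'_def power2_eq_square)
      subgoal by auto
      done
    moreover have "{..s} \<union> {s..} = UNIV" by auto
    moreover have "(if t \<in> {..s} then (\<lambda>h. h * 1) else (\<lambda>h. h * f' t)) = (*) (\<theta>' t)"
      by (auto simp: \<theta>'_def fun_eq_iff)
    ultimately show ?thesis
      unfolding \<theta>_def has_field_derivative_def by simp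
  qed
  have cont: "continuous_on UNIV \<theta>'"
  proof -
    have "continuous_on ({..s} \<union> {s..}) (\<lambda>t. if t \<in> {..s} then 1 else f' t)"
      unfolding f'_def
      by (rule continuous_on_If) (use r in \<open>auto intro!: continuous_intros simp: add_nonneg_eq_0_iff\<close>)
    moreover have "{..s} \<union> {s..} = UNIV" by auto
    ultimately show ?thesis by (simp add: \<theta>'_def[abs_def])
  qed
  have range: "\<theta> t \<in> {0<..<T}" if "t > 0" for t
  proof (cases "t \<le> s")
    case False
    then have "0 < (t - s) * r / (t - s + r)" "(t - s) * r / (t - s + r) < r"
      using r by (auto simp: field_simps)
    then have "0 < f t" "f t < T" using assms unfolding f_def by (simp_all add: r_def)
    then show ?thesis using False by (simp add: \<theta>_def)
  qed (use that assms in \<open>auto simp: \<theta>_def\<close>)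
  show ?thesis
    by (rule that[of \<theta> \<theta>'])
      (use d range cont in \<open>auto intro: continuous_on_subset simp: \<theta>_def \<theta>'_def\<close>)
qed

section \<open>The comparison principle\<close>

text \<open>The next four rules restate the definitions in terms of neighbourhood filters and with all gradient
  terms on one side: a sub-solution satisfies \<open>\<partial>\<^sub>t\<phi> + |\<nabla>\<phi>| \<le> P\<close> where \<open>\<phi>\<close> touches it from above.\<close>

lemma visc_subsolution_interiorD:
  assumes "visc_subsolution_interior \<Omega> \<Gamma> T P f"
    "C1_with_gradient_on ((\<Omega> - \<Gamma>) \<times> {0<..<T}) \<phi> G" "z \<in> (\<Omega> - \<Gamma>) \<times> {0<..<T}"
    "\<forall>\<^sub>F w in nhds z. w \<in> (\<Omega> - \<Gamma>) \<times> {0<..<T} \<longrightarrow> f w - \<phi> w \<le> f z - \<phi> z"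
  shows "snd (G z) + norm (fst (G z)) \<le> P (fst z)"
proof -
  obtain x t where z: "z = (x, t)" by (cases z)
  have "local_max_on ((\<Omega> - \<Gamma>) \<times> {0<..<T}) (\<lambda>z. f z - \<phi> z) (x, t)"
    using assms(3,4) by (simp add: local_max_on_iff_nhds z)
  then show ?thesis
    using assms(1,2) unfolding visc_subsolution_interior_def Let_def z by fastforce
qed

lemma visc_supersolution_interiorD:
  assumes "visc_supersolution_interior \<Omega> \<Gamma> T P f"
    "C1_with_gradient_on ((\<Omega> - \<Gamma>) \<times> {0<..<T}) \<phi> G" "z \<in> (\<Omega> - \<Gamma>) \<times> {0<..<T}"
    "\<forall>\<^sub>F w in nhds z. w \<in> (\<Omega> - \<Gamma>) \<times> {0<..<T} \<longrightarrow> f z - \<phi> z \<le> f w - \<phi> w"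
  shows "snd (G z) + norm (fst (G z)) \<ge> P (fst z)"
proof -
  obtain x t where z: "z = (x, t)" by (cases z)
  have "local_min_on ((\<Omega> - \<Gamma>) \<times> {0<..<T}) (\<lambda>z. f z - \<phi> z) (x, t)"
    using assms(3,4) by (simp add: local_min_on_iff_nhds z)
  then show ?thesis
    using assms(1,2) unfolding visc_supersolution_interior_def Let_def z by fastforce
qed

lemma visc_subsolution_interiorI:
  assumes "usc_on (\<Omega> \<times> {0..T}) f"
    and "\<And>\<phi> G z. C1_with_gradient_on ((\<Omega> - \<Gamma>) \<times> {0<..<T}) \<phi> G \<Longrightarrow> z \<in> (\<Omega> - \<Gamma>) \<times> {0<..<T} \<Longrightarrow>
      \<forall>\<^sub>F w in nhds z. w \<in> (\<Omega> - \<Gamma>) \<times> {0<..<T} \<longrightarrow> f w - \<phi> w \<le> f z - \<phi> z \<Longrightarrow>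
      snd (G z) + norm (fst (G z)) \<le> P (fst z)"
  shows "visc_subsolution_interior \<Omega> \<Gamma> T P f"
  unfolding visc_subsolution_interior_def Let_def local_max_on_iff_nhds
  using assms by fastforce

lemma visc_supersolution_interiorI:
  assumes "lsc_on (\<Omega> \<times> {0..T}) f"
    and "\<And>\<phi> G z. C1_with_gradient_on ((\<Omega> - \<Gamma>) \<times> {0<..<T}) \<phi> G \<Longrightarrow> z \<in> (\<Omega> - \<Gamma>) \<times> {0<..<T} \<Longrightarrow>
      \<forall>\<^sub>F w in nhds z. w \<in> (\<Omega> - \<Gamma>) \<times> {0<..<T} \<longrightarrow> f z - \<phi> z \<le> f w - \<phi> w \<Longrightarrow>
      P (fst z) \<le> snd (G z) + norm (fst (G z))"
  shows "visc_supersolution_interior \<Omega> \<Gamma> T P f"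
  unfolding visc_supersolution_interior_def Let_def local_min_on_iff_nhds
  using assms by fastforce

lemma visc_subsolution_interior_usc:
  "visc_subsolution_interior \<Omega> \<Gamma> T P f \<Longrightarrow> usc_on (\<Omega> \<times> {0..T}) f"
  unfolding visc_subsolution_interior_def by blast

lemma visc_supersolution_interior_lsc:
  "visc_supersolution_interior \<Omega> \<Gamma> T P f \<Longrightarrow> lsc_on (\<Omega> \<times> {0..T}) f"
  unfolding visc_supersolution_interior_def by blast

lemma GDERIV_quadratic_terminal_penalty:
  assumes "snd z \<noteq> T"
  shows "GDERIV (\<lambda>z::'a::real_inner \<times> real. c * inner (z - w) (z - w) + l / (T - snd z)) z
    :> (2 * c) *\<^sub>R (z - w) + (0, l / (T - snd z)\<^sup>2)"
proof (rule GDERIV_add[OF GDERIV_quadratic])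
  have "((\<lambda>t. l / (T - t)) has_real_derivative l / (T - snd z)\<^sup>2) (at (snd z))"
    using assms by (auto intro!: derivative_eq_intros simp: power2_eq_square)
  from GDERIV_DERIV_compose[OF GDERIV_snd this]
  show "GDERIV (\<lambda>z::'a \<times> real. l / (T - snd z)) z :> (0, l / (T - snd z)\<^sup>2)" by simp
qed

text \<open>Doubling of variables. The penalty \<open>l / (T - t)\<close> has two uses: it keeps the maximum away from the
  final time, where nothing is known, and its strictly positive time derivative makes the
  sub-solution inequality strict.\<close>

lemma visc_comparison:
  fixes \<Omega> \<Gamma> :: "'a::euclidean_space set"
  assumes \<Omega>: "compact \<Omega>" and op: "open (\<Omega> - \<Gamma>)"
    and P: "L-lipschitz_on (\<Omega> - \<Gamma>) P"
    and u: "visc_subsolution_interior \<Omega> \<Gamma> T P u"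
    and v: "visc_supersolution_interior \<Omega> \<Gamma> T P v"
    and bd: "\<And>z. z \<in> parabolic_boundary \<Omega> \<Gamma> T \<Longrightarrow> u z \<le> v z"
    and z\<^sub>1: "z\<^sub>1 \<in> \<Omega> \<times> {0..<T}"
  shows "u z\<^sub>1 \<le> v z\<^sub>1"
proof (rule ccontr)
  assume "\<not> u z\<^sub>1 \<le> v z\<^sub>1"
  define U where "U = (\<Omega> - \<Gamma>) \<times> {0<..<T}"
  have t\<^sub>1: "0 \<le> snd z\<^sub>1" "snd z\<^sub>1 < T" "fst z\<^sub>1 \<in> \<Omega>" using z\<^sub>1 by auto
  define c where "c = (u z\<^sub>1 - v z\<^sub>1) / 2"
  have c: "c > 0" using \<open>\<not> u z\<^sub>1 \<le> v z\<^sub>1\<close> by (simp add: c_def)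
  \<comment> \<open>with this weight the penalty at \<open>z\<^sub>1\<close> eats up exactly half of the positive gap there\<close>
  define l where "l = c * (T - snd z\<^sub>1)"
  have l: "l > 0" using c t\<^sub>1 by (simp add: l_def)
  have usc: "usc_on (\<Omega> \<times> {0..T}) u" by (rule visc_subsolution_interior_usc[OF u])
  have lsc: "lsc_on (\<Omega> \<times> {0..T}) v" by (rule visc_supersolution_interior_lsc[OF v])
  have K0: "compact (\<Omega> \<times> {0..T})" "\<Omega> \<times> {0..T} \<noteq> {}" using \<Omega> t\<^sub>1 by (auto intro: compact_Times)
  obtain zu where zu: "\<And>z. z \<in> \<Omega> \<times> {0..T} \<Longrightarrow> u z \<le> u zu"
    using usc_on_attains_max[OF K0 usc] by metis
  obtain zv where zv: "\<And>z. z \<in> \<Omega> \<times> {0..T} \<Longrightarrow> v zv \<le> v z"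
    using usc_on_attains_max[OF K0 lsc[unfolded lsc_on_iff_usc_on_uminus]] by (metis neg_le_iff_le)
  \<comment> \<open>a bound for all differences \<open>u z - v w\<close>; the 1 makes it positive, so that one can divide by it\<close>
  define M where "M = max 1 (u zu - v zv)"
  have M: "u z - v w \<le> M" if "z \<in> \<Omega> \<times> {0..T}" "w \<in> \<Omega> \<times> {0..T}" for z w
    using zu[OF that(1)] zv[OF that(2)] by (simp add: M_def)
  have M0: "M > 0" by (simp add: M_def)
  \<comment> \<open>at and beyond the time \<open>T - l / M\<close> the penalty is at least \<open>M\<close>, so it leaves no positive gap\<close>
  define T\<^sub>2 where "T\<^sub>2 = max (snd z\<^sub>1) (T - l / M)"
  have T\<^sub>2: "T\<^sub>2 < T" "0 \<le> T\<^sub>2" "snd z\<^sub>1 \<le> T\<^sub>2" using t\<^sub>1 l M0 by (auto simp: T\<^sub>2_def)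
  define K where "K = \<Omega> \<times> {0..T\<^sub>2}"
  have K: "compact K" "K \<subseteq> \<Omega> \<times> {0..T}" "z\<^sub>1 \<in> K" "K \<noteq> {}"
    using \<Omega> T\<^sub>2 t\<^sub>1 by (auto simp: K_def mem_Times_iff intro: compact_Times)
  define \<Phi> where "\<Phi> n p = u (fst p) - v (snd p) -
      (real n * inner (fst p - snd p) (fst p - snd p) + l / (T - snd (fst p)))" for n p
  have \<Phi>_usc: "usc_on (K \<times> K) (\<Phi> n)" for n
  proof -
    have "usc_on (K \<times> K) (\<lambda>p. u (fst p))"
      by (rule usc_on_compose[OF usc_on_subset[OF usc K(2)]]) (auto intro!: continuous_intros)
    moreover have "usc_on (K \<times> K) (\<lambda>p. - v (snd p))"
      by (rule usc_on_compose[OF usc_on_subset[OF lsc[unfolded lsc_on_iff_usc_on_uminus] K(2)]])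
        (auto intro!: continuous_intros)
    moreover have "continuous_on (K \<times> K)
      (\<lambda>p. - (real n * inner (fst p - snd p) (fst p - snd p) + l / (T - snd (fst p))))"
      using T\<^sub>2 by (intro continuous_intros) (auto simp: K_def)
    then have "usc_on (K \<times> K)
      (\<lambda>p. - (real n * inner (fst p - snd p) (fst p - snd p) + l / (T - snd (fst p))))"
      by (simp add: continuous_on_iff_usc_lsc)
    ultimately have "usc_on (K \<times> K) (\<lambda>p. (u (fst p) + (- v (snd p))) +
      (- (real n * inner (fst p - snd p) (fst p - snd p) + l / (T - snd (fst p)))))"
      by (intro usc_on_add)
    then show ?thesis unfolding \<Phi>_def by (simp add: algebra_simps)
  qed
  have "\<exists>p\<in>K \<times> K. \<forall>q\<in>K \<times> K. \<Phi> n q \<le> \<Phi> n p" for n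
  proof -
    have "K \<times> K \<noteq> {}" using K(4) by simp
    from usc_on_attains_max[OF compact_Times[OF K(1) K(1)] this \<Phi>_usc[of n]] show ?thesis by metis
  qed
  then obtain p where p: "\<And>n. p n \<in> K \<times> K" "\<And>n q. q \<in> K \<times> K \<Longrightarrow> \<Phi> n q \<le> \<Phi> n (p n)"
    by metis
  have \<Phi>c: "c \<le> \<Phi> n (p n)" for n
  proof -
    have "\<Phi> n (z\<^sub>1, z\<^sub>1) = c" using t\<^sub>1 by (simp add: \<Phi>_def l_def) (simp add: c_def)
    then show ?thesis using p(2)[of "(z\<^sub>1, z\<^sub>1)" n] K by auto
  qed
  have pen: "0 < l / (T - snd (fst (p n)))" for n
    using p(1)[of n] T\<^sub>2 l by (auto simp: K_def mem_Times_iff)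
  have pK: "fst (p n) \<in> \<Omega> \<times> {0..T}" "snd (p n) \<in> \<Omega> \<times> {0..T}" for n
    using p(1)[of n] K(2) by (auto simp: mem_Times_iff)
  have close: "real n * (norm (fst (p n) - snd (p n)))\<^sup>2 \<le> M" for n
    using \<Phi>c[of n] c pen[of n] M[OF pK[of n]]
    unfolding \<Phi>_def power2_norm_eq_inner by linarith
  obtain q r where r: "strict_mono r" and q: "q \<in> K \<times> K" and lim: "(p \<circ> r) \<longlonglongrightarrow> q"
    using seq_compactE[of "K \<times> K" p] compact_Times[OF K(1) K(1)] p(1)
    unfolding compact_eq_seq_compact_metric by metis
  have r_ge: "n \<le> r n" for n using seq_suble[OF r] .
  have lim1: "(\<lambda>n. fst (p (r n))) \<longlonglongrightarrow> fst q" and lim2: "(\<lambda>n. snd (p (r n))) \<longlonglongrightarrow> snd q"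
    using tendsto_fst[OF lim] tendsto_snd[OF lim] by (auto simp: o_def)
  have dist0: "(\<lambda>n. fst (p (r n)) - snd (p (r n))) \<longlonglongrightarrow> 0"
  proof -
    have "(\<lambda>n. (norm (fst (p (r n)) - snd (p (r n))))\<^sup>2) \<longlonglongrightarrow> 0"
    proof (rule tendsto_sandwich[OF _ _ tendsto_const])
      show "\<forall>\<^sub>F n in sequentially. (norm (fst (p (r n)) - snd (p (r n))))\<^sup>2 \<le> M / real n"
        using eventually_gt_at_top[of 0]
      proof eventually_elim
        case (elim n)
        have "real n * (norm (fst (p (r n)) - snd (p (r n))))\<^sup>2
            \<le> real (r n) * (norm (fst (p (r n)) - snd (p (r n))))\<^sup>2"
          using r_ge[of n] by (intro mult_right_mono) auto
        then show ?case using close[of "r n"] elim by (simp add: field_simps)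
      qed
      show "(\<lambda>n. M / real n) \<longlonglongrightarrow> 0" by (rule lim_const_over_n)
    qed simp
    then have "(\<lambda>n. sqrt ((norm (fst (p (r n)) - snd (p (r n))))\<^sup>2)) \<longlonglongrightarrow> sqrt 0"
      by (rule tendsto_real_sqrt)
    then show ?thesis by (simp add: tendsto_norm_zero_iff)
  qed
  have q_diag: "snd q = fst q"
    using LIMSEQ_unique[OF tendsto_diff[OF lim1 lim2] dist0] by simp
  define z where "z = fst q"
  have zK: "z \<in> K" using q by (auto simp: z_def)
  have zT: "0 \<le> snd z" "snd z \<le> T\<^sub>2" "fst z \<in> \<Omega>" using zK by (auto simp: K_def)
  \<comment> \<open>semicontinuity passes the positive gap on to the limit point\<close>
  have gap: "c \<le> u z - v z - l / (T - snd z)"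
  proof (rule field_le_epsilon)
    fix e :: real assume e: "e > 0"
    have zK': "z \<in> \<Omega> \<times> {0..T}" using zK K(2) by blast
    have "\<forall>\<^sub>F w in nhds (fst q). w \<in> \<Omega> \<times> {0..T} \<longrightarrow> u w < u z + e / 3"
      using usc[unfolded usc_on_iff_nhds, rule_format, OF zK', of "u z + e / 3"] e
      by (simp add: z_def)
    from eventually_compose_filterlim[OF this lim1]
    have "\<forall>\<^sub>F n in sequentially. fst (p (r n)) \<in> \<Omega> \<times> {0..T} \<longrightarrow> u (fst (p (r n))) < u z + e / 3" .
    moreover have "\<forall>\<^sub>F w in nhds (snd q). w \<in> \<Omega> \<times> {0..T} \<longrightarrow> v z - e / 3 < v w"
      using lsc[unfolded lsc_on_iff_nhds, rule_format, OF zK', of "v z - e / 3"] e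
      by (simp add: z_def q_diag)
    from eventually_compose_filterlim[OF this lim2]
    have "\<forall>\<^sub>F n in sequentially. snd (p (r n)) \<in> \<Omega> \<times> {0..T} \<longrightarrow> v z - e / 3 < v (snd (p (r n)))" .
    moreover have "(\<lambda>n. l / (T - snd (fst (p (r n))))) \<longlonglongrightarrow> l / (T - snd z)"
      using zT T\<^sub>2 unfolding z_def by (intro tendsto_intros lim1) auto
    then have "\<forall>\<^sub>F n in sequentially. l / (T - snd z) - e / 3 < l / (T - snd (fst (p (r n))))"
      using e by (intro order_tendstoD(1)) auto
    ultimately have "\<forall>\<^sub>F n in sequentially. c \<le> u z - v z - l / (T - snd z) + e"
    proof eventually_elim
      case (elim n)
      have "0 \<le> real (r n) * inner (fst (p (r n)) - snd (p (r n))) (fst (p (r n)) - snd (p (r n)))"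
        by simp
      moreover have "u (fst (p (r n))) < u z + e / 3" "v z - e / 3 < v (snd (p (r n)))"
        using elim pK[of "r n"] by blast+
      ultimately show ?case using elim(3) \<Phi>c[of "r n"] unfolding \<Phi>_def by linarith
    qed
    then show "c \<le> u z - v z - l / (T - snd z) + e" by simp
  qed
  have "u z - v z > 0" using gap c l zT T\<^sub>2
    by (smt (verit) divide_pos_pos)
  then have "z \<notin> parabolic_boundary \<Omega> \<Gamma> T" using bd[of z] by auto
  then have z_int: "fst z \<notin> \<Gamma>" "0 < snd z"
    using zT T\<^sub>2 unfolding parabolic_boundary_def by (auto simp: mem_Times_iff less_le)
  have z_lt: "snd z < T\<^sub>2"
  proof (rule ccontr)
    assume "\<not> snd z < T\<^sub>2"
    then have "T - snd z \<le> l / M" using zT by (auto simp: T\<^sub>2_def)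
    then have "M \<le> l / (T - snd z)" using M0 l zT T\<^sub>2 by (simp add: field_simps)
    then show False using gap c M[of z z] zK K(2) by auto
  qed
  define V where "V = (\<Omega> - \<Gamma>) \<times> {0<..<T\<^sub>2}"
  have V: "open V" "V \<subseteq> K" "V \<subseteq> U" "z \<in> V"
    using op T\<^sub>2 z_int z_lt zT by (auto simp: V_def K_def U_def mem_Times_iff intro: open_Times)
  have "\<forall>\<^sub>F n in sequentially. fst (p (r n)) \<in> V" "\<forall>\<^sub>F n in sequentially. snd (p (r n)) \<in> V"
    using topological_tendstoD[OF lim1 V(1)] topological_tendstoD[OF lim2 V(1)] V(4) q_diag
    by (auto simp: z_def)
  moreover have "(\<lambda>n. L * norm (fst (p (r n)) - snd (p (r n)))) \<longlonglongrightarrow> 0"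
    by (intro tendsto_mult_right_zero tendsto_norm_zero dist0)
  then have "\<forall>\<^sub>F n in sequentially. L * norm (fst (p (r n)) - snd (p (r n))) < l / T\<^sup>2"
    using l T\<^sub>2 by (intro order_tendstoD(2)) auto
  ultimately have "\<forall>\<^sub>F n in sequentially. False"
  proof eventually_elim
    case (elim n)
    define N where "N = r n"
    define a where "a = fst (p N)"
    define b where "b = snd (p N)"
    have ab: "a \<in> V" "b \<in> V" using elim by (auto simp: a_def b_def N_def)
    have pN: "p N = (a, b)" by (simp add: a_def b_def)
    have aU: "a \<in> U" "b \<in> U" using ab V by auto
    \<comment> \<open>freezing one of the two maximisers gives a test function for the other variable\<close>
    have "C1_with_gradient_on U (\<lambda>z. real N * inner (z - b) (z - b) + l / (T - snd z))
        (\<lambda>z. (2 * real N) *\<^sub>R (z - b) + (0, l / (T - snd z)\<^sup>2))"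
      unfolding C1_with_gradient_on_def
    proof
      show "\<forall>z\<in>U. GDERIV (\<lambda>z. real N * inner (z - b) (z - b) + l / (T - snd z)) z
          :> (2 * real N) *\<^sub>R (z - b) + (0, l / (T - snd z)\<^sup>2)"
        by (intro ballI GDERIV_quadratic_terminal_penalty) (auto simp: U_def)
      show "continuous_on U (\<lambda>z. (2 * real N) *\<^sub>R (z - b) + (0, l / (T - snd z)\<^sup>2))"
        by (intro continuous_intros) (auto simp: U_def)
    qed
    moreover have "\<forall>\<^sub>F w in nhds a. w \<in> U \<longrightarrow>
        u w - (real N * inner (w - b) (w - b) + l / (T - snd w))
        \<le> u a - (real N * inner (a - b) (a - b) + l / (T - snd a))"
      using eventually_nhds_in_open[OF V(1) ab(1)]
    proof eventually_elim
      case (elim w)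
      then have "(w, b) \<in> K \<times> K" using ab V by auto
      from p(2)[OF this, of N] show ?case by (simp add: \<Phi>_def pN)
    qed
    ultimately have sub: "snd ((2 * real N) *\<^sub>R (a - b) + (0, l / (T - snd a)\<^sup>2)) +
        norm (fst ((2 * real N) *\<^sub>R (a - b) + (0, l / (T - snd a)\<^sup>2))) \<le> P (fst a)"
      using visc_subsolution_interiorD[OF u, folded U_def] aU by blast
    have "\<forall>\<^sub>F w in nhds b. w \<in> U \<longrightarrow>
        v b - (- real N) * inner (b - a) (b - a) \<le> v w - (- real N) * inner (w - a) (w - a)"
      using eventually_nhds_in_open[OF V(1) ab(2)]
    proof eventually_elim
      case (elim w)
      then have "(a, w) \<in> K \<times> K" using ab V by auto
      moreover have "inner (a - w) (a - w) = inner (w - a) (w - a)" for w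
        by (simp add: inner_diff_left inner_diff_right inner_commute)
      ultimately show ?case using p(2)[of "(a, w)" N] by (simp add: \<Phi>_def pN)
    qed
    with visc_supersolution_interiorD[OF v, folded U_def, OF C1_with_gradient_on_quadratic aU(2)]
    have super: "P (fst b) \<le> snd ((2 * (- real N)) *\<^sub>R (b - a)) +
        norm (fst ((2 * (- real N)) *\<^sub>R (b - a)))" .
    have "(2 * (- real N)) *\<^sub>R (b - a) = (2 * real N) *\<^sub>R (a - b)"
      by (simp add: scaleR_right_diff_distrib)
    then have "l / (T - snd a)\<^sup>2 \<le> P (fst a) - P (fst b)" using sub super by simp
    also have "\<dots> \<le> L * dist (fst a) (fst b)"
      using lipschitz_onD[OF P, of "fst a" "fst b"] aU by (auto simp: U_def dist_real_def)
    also have "\<dots> \<le> L * norm (a - b)"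
      using lipschitz_on_nonneg[OF P] dist_fst_le[of a b]
      by (intro mult_left_mono) (auto simp: dist_norm)
    also have "\<dots> < l / T\<^sup>2" using elim by (simp add: a_def b_def N_def)
    also have "\<dots> \<le> l / (T - snd a)\<^sup>2"
      using aU l by (intro divide_left_mono power_mono) (auto simp: U_def)
    finally show ?case by simp
  qed
  then show False by simp
qed

section \<open>Perron's method\<close>

text \<open>At a point where the maximum equals \<open>f\<close>, a function that touches the maximum from above
  also touches \<open>f\<close> from above.\<close>

lemma visc_subsolution_interior_max:
  assumes "visc_subsolution_interior \<Omega> \<Gamma> T P f" "visc_subsolution_interior \<Omega> \<Gamma> T P g"
  shows "visc_subsolution_interior \<Omega> \<Gamma> T P (\<lambda>z. max (f z) (g z))"
proof (rule visc_subsolution_interiorI)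
  show "usc_on (\<Omega> \<times> {0..T}) (\<lambda>z. max (f z) (g z))"
    using assms[THEN visc_subsolution_interior_usc] by (rule usc_on_max)
next
  let ?U = "(\<Omega> - \<Gamma>) \<times> {0<..<T}"
  fix \<phi> G z
  assume \<phi>: "C1_with_gradient_on ?U \<phi> G" and z: "z \<in> ?U"
    and max: "\<forall>\<^sub>F w in nhds z. w \<in> ?U \<longrightarrow> max (f w) (g w) - \<phi> w \<le> max (f z) (g z) - \<phi> z"
  show "snd (G z) + norm (fst (G z)) \<le> P (fst z)"
  proof (cases "g z \<le> f z")
    case True
    then have "\<forall>\<^sub>F w in nhds z. w \<in> ?U \<longrightarrow> f w - \<phi> w \<le> f z - \<phi> z"
      using max by (auto elim!: eventually_mono)
    then show ?thesis by (rule visc_subsolution_interiorD[OF assms(1) \<phi> z])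
  next
    case False
    then have "\<forall>\<^sub>F w in nhds z. w \<in> ?U \<longrightarrow> g w - \<phi> w \<le> g z - \<phi> z"
      using max by (auto elim!: eventually_mono)
    then show ?thesis by (rule visc_subsolution_interiorD[OF assms(2) \<phi> z])
  qed
qed

lemma lsc_on_min: "lsc_on S f \<Longrightarrow> lsc_on S g \<Longrightarrow> lsc_on S (\<lambda>z. min (f z) (g z))"
  unfolding lsc_on_def by (auto intro: eventually_conj)

lemma visc_supersolution_interior_min:
  assumes "visc_supersolution_interior \<Omega> \<Gamma> T P f" "visc_supersolution_interior \<Omega> \<Gamma> T P g"
  shows "visc_supersolution_interior \<Omega> \<Gamma> T P (\<lambda>z. min (f z) (g z))"
proof (rule visc_supersolution_interiorI)
  show "lsc_on (\<Omega> \<times> {0..T}) (\<lambda>z. min (f z) (g z))"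
    using assms[THEN visc_supersolution_interior_lsc] by (rule lsc_on_min)
next
  let ?U = "(\<Omega> - \<Gamma>) \<times> {0<..<T}"
  fix \<phi> G z
  assume \<phi>: "C1_with_gradient_on ?U \<phi> G" and z: "z \<in> ?U"
    and min: "\<forall>\<^sub>F w in nhds z. w \<in> ?U \<longrightarrow> min (f z) (g z) - \<phi> z \<le> min (f w) (g w) - \<phi> w"
  show "P (fst z) \<le> snd (G z) + norm (fst (G z))"
  proof (cases "f z \<le> g z")
    case True
    then have "\<forall>\<^sub>F w in nhds z. w \<in> ?U \<longrightarrow> f z - \<phi> z \<le> f w - \<phi> w"
      using min by (auto elim!: eventually_mono)
    then show ?thesis by (rule visc_supersolution_interiorD[OF assms(1) \<phi> z])
  next
    case False
    then have "\<forall>\<^sub>F w in nhds z. w \<in> ?U \<longrightarrow> g z - \<phi> z \<le> g w - \<phi> w"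
      using min by (auto elim!: eventually_mono)
    then show ?thesis by (rule visc_supersolution_interiorD[OF assms(2) \<phi> z])
  qed
qed

lemma continuous_on_residual:
  fixes G :: "'a::real_normed_vector \<times> real \<Rightarrow> 'a \<times> real"
  assumes "continuous_on (D \<times> I) G" "continuous_on D P"
  shows "continuous_on (D \<times> I) (\<lambda>z. snd (G z) + norm (fst (G z)) - P (fst z))"
proof -
  have "continuous_on (D \<times> I) (\<lambda>z. P (fst z))"
    by (rule continuous_on_compose2[OF assms(2)]) (auto intro!: continuous_intros)
  then show ?thesis by (intro continuous_intros assms(1))
qed

text \<open>Stability under suprema. Let \<open>\<phi>\<close> touch the envelope from above at \<open>z\<close>. Adding \<open>|y - z|\<^sup>2\<close> makes the
  contact strict; hence a member of the family that almost attains the envelope near \<open>z\<close> is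
  touched by a shifted copy of the perturbed function at some point close to \<open>z\<close>. The inequality at
  such points passes to \<open>z\<close> by continuity of the gradient and of \<open>P\<close>.\<close>

lemma visc_subsolution_interior_Sup:
  fixes \<Omega> \<Gamma> :: "'a::euclidean_space set"
  assumes op: "open (\<Omega> - \<Gamma>)" and P: "continuous_on (\<Omega> - \<Gamma>) P"
    and sub: "\<And>w. w \<in> S \<Longrightarrow> visc_subsolution_interior \<Omega> \<Gamma> T P w"
    and lb: "locally_bounded_on (\<Omega> \<times> {0..T}) f"
    and upper: "\<And>w z. w \<in> S \<Longrightarrow> z \<in> \<Omega> \<times> {0..T} \<Longrightarrow> w z \<le> f z"
    and least: "\<And>z a. z \<in> \<Omega> \<times> {0..T} \<Longrightarrow> a < f z \<Longrightarrow> \<exists>w\<in>S. a < w z"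
  shows "visc_subsolution_interior \<Omega> \<Gamma> T P (usc_envelope (\<Omega> \<times> {0..T}) f)"
proof (rule visc_subsolution_interiorI)
  define K where "K = \<Omega> \<times> {0..T}"
  define F where "F = usc_envelope K f"
  show "usc_on (\<Omega> \<times> {0..T}) (usc_envelope (\<Omega> \<times> {0..T}) f)"
    by (rule usc_on_usc_envelope[OF lb])
  fix \<phi> G z
  define U where "U = (\<Omega> - \<Gamma>) \<times> {0<..<T}"
  assume "C1_with_gradient_on ((\<Omega> - \<Gamma>) \<times> {0<..<T}) \<phi> G" and "z \<in> (\<Omega> - \<Gamma>) \<times> {0<..<T}"
    and "\<forall>\<^sub>F w in nhds z. w \<in> (\<Omega> - \<Gamma>) \<times> {0<..<T} \<longrightarrow>
      usc_envelope (\<Omega> \<times> {0..T}) f w - \<phi> w \<le> usc_envelope (\<Omega> \<times> {0..T}) f z - \<phi> z"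
  then have \<phi>: "C1_with_gradient_on U \<phi> G" and z: "z \<in> U"
    and max: "\<forall>\<^sub>F w in nhds z. w \<in> U \<longrightarrow> F w - \<phi> w \<le> F z - \<phi> z"
    by (simp_all add: U_def F_def K_def)
  have U: "open U" "U \<subseteq> K" using op by (auto simp: U_def K_def intro: open_Times)
  define \<psi> where "\<psi> y = \<phi> y + 1 * inner (y - z) (y - z)" for y
  define H where "H y = G y + (2 * 1) *\<^sub>R (y - z)" for y
  have \<psi>: "C1_with_gradient_on U \<psi> H"
    unfolding \<psi>_def[abs_def] H_def[abs_def]
    by (intro C1_with_gradient_on_add \<phi> C1_with_gradient_on_quadratic)
  have cont_\<psi>: "isCont \<psi> z"
    using C1_with_gradient_onD[OF \<psi> z] by (rule has_derivative_continuous)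
  have "\<forall>\<^sub>F w in nhds z. w \<in> U \<and> F w - \<phi> w \<le> F z - \<phi> z"
    using eventually_nhds_in_open[OF U(1) z] max by eventually_elim auto
  then obtain r where r: "r > 0" "\<And>w. dist w z < r \<Longrightarrow> w \<in> U \<and> F w - \<phi> w \<le> F z - \<phi> z"
    unfolding eventually_nhds_metric by blast
  have approx: "\<exists>y. dist y z < e \<and> snd (H y) + norm (fst (H y)) \<le> P (fst y)"
    if e: "0 < e" "e < r" for e
  proof -
    \<comment> \<open>the error \<open>2 * \<delta>\<close> made below has to stay under \<open>e\<^sup>2\<close>, so that the maximum lies inside the ball\<close>
    define \<delta> where "\<delta> = e\<^sup>2 / 8"
    have \<delta>: "\<delta> > 0" using e by (simp add: \<delta>_def)
    have "\<exists>\<^sub>F w in nhds z. w \<in> K \<and> F z - \<delta> < f w"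
    proof (rule ccontr)
      assume "\<not> ?thesis"
      then have "\<forall>\<^sub>F w in nhds z. w \<in> K \<longrightarrow> f w \<le> F z - \<delta>"
        unfolding not_frequently by (auto elim: eventually_mono)
      then have "F z \<le> F z - \<delta>"
        using z U lb unfolding F_def K_def by (intro usc_envelope_leI) auto
      then show False using \<delta> by simp
    qed
    moreover have "\<forall>\<^sub>F w in nhds z. \<psi> w < \<psi> z + \<delta>"
      using order_tendstoD(2)[OF cont_\<psi>[unfolded continuous_at], of "\<psi> z + \<delta>"] \<delta>
      unfolding eventually_nhds_conv_at by simp
    moreover have "\<forall>\<^sub>F w in nhds z. dist w z < e"
      using e unfolding eventually_nhds_metric by blast
    ultimately have "\<exists>\<^sub>F w in nhds z. (w \<in> K \<and> F z - \<delta> < f w) \<and> (\<psi> w < \<psi> z + \<delta> \<and> dist w z < e)"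
      by (rule frequently_eventually_frequently[OF _ eventually_conj])
    then obtain a where a: "a \<in> K" "F z - \<delta> < f a" "\<psi> a < \<psi> z + \<delta>" "dist a z < e"
      by (auto dest: frequently_ex)
    then obtain w where w: "w \<in> S" "F z - \<delta> < w a" using least K_def by blast
    have cb: "cball z e \<subseteq> U" using r(2) e by (auto simp: dist_commute)
    have "usc_on (cball z e) (\<lambda>y. w y + - \<psi> y)"
    proof (rule usc_on_add)
      show "usc_on (cball z e) w"
        using visc_subsolution_interior_usc[OF sub[OF w(1)]] cb U K_def usc_on_subset by blast
      have "continuous_on U \<psi>"
        by (meson C1_with_gradient_onD[OF \<psi>] has_derivative_at_withinI has_derivative_continuous_on)
      then have "continuous_on (cball z e) (\<lambda>y. - \<psi> y)"
        using cb by (intro continuous_intros) (rule continuous_on_subset)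
      then show "usc_on (cball z e) (\<lambda>y. - \<psi> y)" by (simp add: continuous_on_iff_usc_lsc)
    qed
    moreover have "compact (cball z e)" "cball z e \<noteq> {}" using e by auto
    ultimately obtain y
      where y: "y \<in> cball z e" "\<And>x. x \<in> cball z e \<Longrightarrow> w x + - \<psi> x \<le> w y + - \<psi> y"
      using usc_on_attains_max by (metis (no_types, lifting))
    have "w a - \<psi> a \<le> w y - \<psi> y" using y(2)[of a] a by (simp add: dist_commute)
    moreover have "w y \<le> f y" using upper w y(1) cb U K_def by blast
    moreover have "f y \<le> F y"
      using le_usc_envelope[OF lb] y(1) cb U unfolding F_def K_def by blast
    moreover have "F y - \<phi> y \<le> F z - \<phi> z" using r(2)[of y] y e by (simp add: dist_commute)
    moreover have "\<psi> z = \<phi> z" by (simp add: \<psi>_def)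
    ultimately have "inner (y - z) (y - z) < 2 * \<delta>"
      using a w by (simp add: \<psi>_def)
    moreover have "2 * \<delta> \<le> e\<^sup>2" by (simp add: \<delta>_def)
    ultimately have "(dist y z)\<^sup>2 < e\<^sup>2"
      unfolding dist_norm power2_norm_eq_inner by linarith
    then have yz: "dist y z < e" using e by (simp add: power2_less_imp_less)
    have "\<forall>\<^sub>F x in nhds y. x \<in> ball z e"
      using yz by (intro eventually_nhds_in_open) (auto simp: dist_commute)
    then have "\<forall>\<^sub>F x in nhds y. x \<in> U \<longrightarrow> w x - \<psi> x \<le> w y - \<psi> y"
    proof eventually_elim
      case (elim x)
      then show ?case using y(2)[of x] by simp
    qed
    then have "snd (H y) + norm (fst (H y)) \<le> P (fst y)"
      using visc_subsolution_interiorD[OF sub[OF w(1)], folded U_def, OF \<psi>] y(1) cb by blast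
    then show ?thesis using yz by blast
  qed
  have "continuous_on U H" using \<psi> unfolding C1_with_gradient_on_def by blast
  then have "continuous_on U (\<lambda>y. snd (H y) + norm (fst (H y)) - P (fst y))"
    unfolding U_def using P by (rule continuous_on_residual)
  then have lim: "((\<lambda>y. snd (H y) + norm (fst (H y)) - P (fst y)) \<longlongrightarrow>
      snd (H z) + norm (fst (H z)) - P (fst z)) (at z)"
    using continuous_on_interior[of U _ z] z interior_open[OF U(1)] unfolding isCont_def by blast
  have "snd (H z) + norm (fst (H z)) - P (fst z) \<le> 0"
  proof (rule ccontr)
    assume pos: "\<not> ?thesis"
    then have "\<forall>\<^sub>F y in nhds z. 0 < snd (H y) + norm (fst (H y)) - P (fst y)"
      using order_tendstoD(1)[OF lim, of 0] unfolding eventually_nhds_conv_at by simp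
    then obtain d where d: "d > 0" "\<And>y. dist y z < d \<Longrightarrow> 0 < snd (H y) + norm (fst (H y)) - P (fst y)"
      unfolding eventually_nhds_metric by blast
    then show False using approx[of "min d (r / 2)"] r(1) by fastforce
  qed
  then show "snd (G z) + norm (fst (G z)) \<le> P (fst z)" by (simp add: H_def)
qed

text \<open>Where the raised function exceeds \<open>F\<close> it coincides with a classical sub-solution. The overlap
  condition on the rim makes the two pieces agree there, so the case distinction introduces
  no new contact points and keeps the result upper semicontinuous.\<close>

lemma visc_subsolution_interior_bump:
  fixes \<Omega> \<Gamma> :: "'a::euclidean_space set"
  assumes F: "visc_subsolution_interior \<Omega> \<Gamma> T P F"
    and \<phi>: "C1_with_gradient_on ((\<Omega> - \<Gamma>) \<times> {0<..<T}) \<phi> G"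
    and r: "0 < r" "cball z r \<subseteq> (\<Omega> - \<Gamma>) \<times> {0<..<T}"
    and classical: "\<And>y. y \<in> cball z r \<Longrightarrow> snd (G y) + norm (fst (G y)) \<le> P (fst y)"
    and rim: "\<And>y. y \<in> cball z r \<Longrightarrow> r / 2 \<le> dist z y \<Longrightarrow> \<phi> y \<le> F y"
  shows "visc_subsolution_interior \<Omega> \<Gamma> T P (\<lambda>y. if y \<in> cball z r then max (F y) (\<phi> y) else F y)"
    (is "visc_subsolution_interior _ _ _ _ ?w")
proof (rule visc_subsolution_interiorI)
  let ?U = "(\<Omega> - \<Gamma>) \<times> {0<..<T}"
  have usc: "usc_on (\<Omega> \<times> {0..T}) F" by (rule visc_subsolution_interior_usc[OF F])
  have w_F: "?w y = F y" if "r / 2 \<le> dist z y" for y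
    using rim[of y] that by auto
  show "usc_on (\<Omega> \<times> {0..T}) ?w"
    unfolding usc_on_iff_nhds
  proof (intro ballI allI impI)
    fix y a assume y: "y \<in> \<Omega> \<times> {0..T}" and a: "?w y < a"
    then have "F y < a" by (auto split: if_splits)
    then have ev: "\<forall>\<^sub>F x in nhds y. x \<in> \<Omega> \<times> {0..T} \<longrightarrow> F x < a"
      using usc y unfolding usc_on_iff_nhds by blast
    show "\<forall>\<^sub>F x in nhds y. x \<in> \<Omega> \<times> {0..T} \<longrightarrow> ?w x < a"
    proof (cases "dist z y < r")
      case True
      then have "y \<in> ?U" using r(2) by auto
      then have "isCont \<phi> y"
        using C1_with_gradient_onD[OF \<phi>] has_derivative_continuous by blast
      moreover have "\<phi> y < a" using a True by auto
      ultimately have "\<forall>\<^sub>F x in nhds y. \<phi> x < a"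
        using order_tendstoD(2)[of \<phi> "\<phi> y" "at y" a]
        unfolding eventually_nhds_conv_at by (simp add: continuous_at)
      with ev show ?thesis by eventually_elim auto
    next
      case False
      then have "y \<in> - cball z (r / 2)" using r(1) by auto
      then have "\<forall>\<^sub>F x in nhds y. x \<in> - cball z (r / 2)"
        by (intro eventually_nhds_in_open) auto
      with ev show ?thesis by eventually_elim (use w_F in auto)
    qed
  qed
  fix \<eta> H y
  assume \<eta>: "C1_with_gradient_on ?U \<eta> H" and y: "y \<in> ?U"
    and max: "\<forall>\<^sub>F x in nhds y. x \<in> ?U \<longrightarrow> ?w x - \<eta> x \<le> ?w y - \<eta> y"
  show "snd (H y) + norm (fst (H y)) \<le> P (fst y)"
  proof (cases "?w y = F y")
    case True
    have "\<forall>\<^sub>F x in nhds y. x \<in> ?U \<longrightarrow> F x - \<eta> x \<le> F y - \<eta> y"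
      using max unfolding True by eventually_elim (auto split: if_splits)
    then show ?thesis by (rule visc_subsolution_interiorD[OF F \<eta> y])
  next
    case False
    then have near: "dist z y < r" using w_F[of y] r(1) by (cases "dist z y < r") auto
    with False have wy: "?w y = \<phi> y" by (auto split: if_splits simp: max_def)
    have "\<forall>\<^sub>F x in nhds y. x \<in> ball z r" using near by (intro eventually_nhds_in_open) auto
    with max have "\<forall>\<^sub>F x in nhds y. \<phi> x - \<eta> x \<le> \<phi> y - \<eta> y"
      unfolding wy
    proof eventually_elim
      case (elim x)
      then have "x \<in> ?U" "x \<in> cball z r" using r(2) by auto
      then show ?case using elim by auto
    qed
    then have "G y = H y"
      using \<phi> \<eta> y unfolding C1_with_gradient_on_def by (intro gradient_eq_of_local_max) auto
    then show ?thesis using classical[of y] near by simp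
  qed
qed

text \<open>The supremum runs over all sub-solutions below \<open>h\<close>. A bumped sub-solution competes in it because
  comparison with \<open>h\<close> keeps it below \<open>h\<close>. Two functions are returned because they need not agree
  at the final time.\<close>

lemma visc_perron:
  fixes \<Omega> \<Gamma> :: "'a::euclidean_space set"
  assumes \<Omega>: "compact \<Omega>" and op: "open (\<Omega> - \<Gamma>)" and P: "L-lipschitz_on (\<Omega> - \<Gamma>) P"
    and k: "visc_subsolution_interior \<Omega> \<Gamma> T P k" "continuous_on (\<Omega> \<times> {0..T}) k"
    and h: "visc_supersolution_interior \<Omega> \<Gamma> T P h" "continuous_on (\<Omega> \<times> {0..T}) h"
    and kh: "\<And>z. z \<in> \<Omega> \<times> {0..T} \<Longrightarrow> k z \<le> h z"
    and bd: "\<And>z. z \<in> parabolic_boundary \<Omega> \<Gamma> T \<Longrightarrow> k z = h z"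
    and \<Gamma>: "\<Gamma> \<subseteq> \<Omega>" and T: "0 < T"
  obtains f g where "visc_subsolution_interior \<Omega> \<Gamma> T P f" "visc_supersolution_interior \<Omega> \<Gamma> T P g"
    "\<And>z. z \<in> \<Omega> \<times> {0..<T} \<Longrightarrow> f z = g z" "\<And>z. z \<in> \<Omega> \<times> {0..T} \<Longrightarrow> k z \<le> f z \<and> f z \<le> h z"
proof -
  define K where "K = \<Omega> \<times> {0..T}"
  define U where "U = (\<Omega> - \<Gamma>) \<times> {0<..<T}"
  have U: "open U" "U \<subseteq> K" using op by (auto simp: U_def K_def intro: open_Times)
  have PK: "parabolic_boundary \<Omega> \<Gamma> T \<subseteq> K" "parabolic_boundary \<Omega> \<Gamma> T \<inter> U = {}"
    using \<Gamma> T by (auto simp: parabolic_boundary_def K_def U_def)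
  have contP: "continuous_on (\<Omega> - \<Gamma>) P" using P by (rule lipschitz_on_continuous_on)
  define S where "S = {w. visc_subsolution_interior \<Omega> \<Gamma> T P w \<and> (\<forall>z\<in>K. w z \<le> h z)}"
  have kS: "k \<in> S" using k kh by (auto simp: S_def K_def)
  define f where "f z = (SUP w\<in>S. w z)" for z
  have bdd: "bdd_above ((\<lambda>w. w z) ` S)" if "z \<in> K" for z
    using that by (auto simp: S_def intro!: bdd_aboveI2)
  have f_ge: "w z \<le> f z" if "w \<in> S" "z \<in> K" for w z
    unfolding f_def using that bdd by (intro cSUP_upper) auto
  have f_le: "f z \<le> h z" if "z \<in> K" for z
    unfolding f_def using kS that by (intro cSUP_least) (auto simp: S_def)
  have "compact K" using \<Omega> by (auto simp: K_def intro: compact_Times)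
  then have "bounded (k ` K)" "bounded (h ` K)"
    using k(2) h(2) by (auto simp: K_def intro!: compact_imp_bounded compact_continuous_image)
  then obtain B B' where B: "\<And>z. z \<in> K \<Longrightarrow> \<bar>k z\<bar> \<le> B" "\<And>z. z \<in> K \<Longrightarrow> \<bar>h z\<bar> \<le> B'"
    unfolding bounded_iff by (metis imageI real_norm_def)
  have lb_between: "locally_bounded_on K q" if "\<And>z. z \<in> K \<Longrightarrow> k z \<le> q z \<and> q z \<le> h z" for q
  proof (rule locally_bounded_on_bounded)
    have "\<bar>q z\<bar> \<le> max B B'" if "z \<in> K" for z
      using B[OF that] \<open>z \<in> K \<Longrightarrow> k z \<le> q z \<and> q z \<le> h z\<close>[OF that] by linarith
    then show "bounded (q ` K)" by (intro boundedI[of _ "max B B'"]) auto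
  qed
  have lb: "locally_bounded_on K f" using f_ge[OF kS] f_le by (intro lb_between) auto
  define F where "F = usc_envelope K f"
  have F_sub: "visc_subsolution_interior \<Omega> \<Gamma> T P F"
    unfolding F_def K_def
  proof (rule visc_subsolution_interior_Sup[OF op contP, where S = S])
    fix z a assume "z \<in> \<Omega> \<times> {0..T}" "a < f z"
    then show "\<exists>w\<in>S. a < w z"
      using less_cSUP_iff[OF _ bdd, of z a] kS unfolding f_def K_def by auto
  qed (use lb f_ge in \<open>auto simp: S_def K_def\<close>)
  have F_h: "F z \<le> h z" if "z \<in> K" for z
    unfolding F_def using h(2) f_le that
    by (intro usc_envelope_le_usc[OF lb]) (auto simp: continuous_on_iff_usc_lsc K_def)
  have fF: "f z \<le> F z" if "z \<in> K" for z
    unfolding F_def by (rule le_usc_envelope[OF lb that])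
  have kF: "k z \<le> F z" if "z \<in> K" for z
    using fF[OF that] f_ge[OF kS that] by simp
  have lbF: "locally_bounded_on K F" using kF F_h by (intro lb_between) auto
  define E where "E = lsc_envelope K F"
  have EF: "E z \<le> F z" if "z \<in> K" for z
    unfolding E_def by (rule lsc_envelope_le[OF lbF that])
  have kE: "k z \<le> E z" if "z \<in> K" for z
    unfolding E_def using k(2) kF that
    by (intro lsc_le_lsc_envelope[OF lbF]) (auto simp: continuous_on_iff_usc_lsc K_def)
  have E_super: "visc_supersolution_interior \<Omega> \<Gamma> T P E"
  proof (rule visc_supersolution_interiorI)
    show "lsc_on (\<Omega> \<times> {0..T}) E"
      using lsc_on_lsc_envelope[OF lbF] by (simp add: E_def K_def)
    fix \<phi> G z
    assume "C1_with_gradient_on ((\<Omega> - \<Gamma>) \<times> {0<..<T}) \<phi> G" and "z \<in> (\<Omega> - \<Gamma>) \<times> {0<..<T}"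
      and "\<forall>\<^sub>F w in nhds z. w \<in> (\<Omega> - \<Gamma>) \<times> {0<..<T} \<longrightarrow> E z - \<phi> z \<le> E w - \<phi> w"
    then have \<phi>: "C1_with_gradient_on U \<phi> G" and z: "z \<in> U"
      and min: "\<forall>\<^sub>F w in nhds z. w \<in> U \<longrightarrow> E z - \<phi> z \<le> E w - \<phi> w"
      by (simp_all add: U_def)
    show "P (fst z) \<le> snd (G z) + norm (fst (G z))"
    proof (rule ccontr)
      assume strict: "\<not> ?thesis"
      define H where "H y = G y + (2 * - 1) *\<^sub>R (y - z)" for y
      define \<psi> where "\<psi> c y = (\<phi> y + (- 1) * inner (y - z) (y - z)) + c" for c y
      have \<psi>: "C1_with_gradient_on U (\<psi> c) H" for c
      proof -
        have "C1_with_gradient_on U (\<lambda>_. c) (\<lambda>_. 0)"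
          unfolding C1_with_gradient_on_def by (auto intro: GDERIV_const)
        then have "C1_with_gradient_on U (\<psi> c) (\<lambda>y. H y + 0)"
          unfolding \<psi>_def[abs_def] H_def[abs_def]
          by (intro C1_with_gradient_on_add \<phi> C1_with_gradient_on_quadratic)
        then show ?thesis by simp
      qed
      have "continuous_on U H" using \<psi> unfolding C1_with_gradient_on_def by blast
      then have "continuous_on U (\<lambda>y. snd (H y) + norm (fst (H y)) - P (fst y))"
        unfolding U_def using contP by (rule continuous_on_residual)
      then have lim: "((\<lambda>y. snd (H y) + norm (fst (H y)) - P (fst y)) \<longlongrightarrow>
          snd (H z) + norm (fst (H z)) - P (fst z)) (at z)"
        using continuous_on_interior[of U _ z] z interior_open[OF U(1)] unfolding isCont_def by blast
      have neg: "snd (H z) + norm (fst (H z)) - P (fst z) < 0"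
        using strict by (simp add: H_def)
      have "\<forall>\<^sub>F y in nhds z. snd (H y) + norm (fst (H y)) - P (fst y) < 0"
        unfolding eventually_nhds_conv_at using order_tendstoD(2)[OF lim neg] neg by simp
      then have "\<forall>\<^sub>F y in nhds z. y \<in> U \<and> E z - \<phi> z \<le> E y - \<phi> y \<and>
          snd (H y) + norm (fst (H y)) - P (fst y) < 0"
        using eventually_nhds_in_open[OF U(1) z] min by eventually_elim auto
      then obtain d where d: "d > 0" "\<And>y. dist y z < d \<Longrightarrow> y \<in> U \<and> E z - \<phi> z \<le> E y - \<phi> y \<and>
          snd (H y) + norm (fst (H y)) - P (fst y) < 0"
        unfolding eventually_nhds_metric by blast
      define r where "r = d / 2"
      have r: "r > 0" using d by (simp add: r_def)
      have near: "y \<in> U \<and> E z - \<phi> z \<le> E y - \<phi> y \<and> snd (H y) + norm (fst (H y)) - P (fst y) < 0"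
        if "y \<in> cball z r" for y using d(2)[of y] d(1) that by (auto simp: r_def dist_commute)
      \<comment> \<open>contact at height \<open>E z\<close>, lifted as far as the strictness \<open>|y - z|\<^sup>2 \<ge> (r/2)\<^sup>2\<close> on the rim allows\<close>
      define c where "c = E z - \<phi> z + r\<^sup>2 / 4"
      \<comment> \<open>the competitor that exceeds \<open>F\<close> at points close to \<open>z\<close>\<close>
      define w where "w y = (if y \<in> cball z r then max (F y) (\<psi> c y) else F y)" for y
      have cbU: "cball z r \<subseteq> U" using near by auto
      have w_sub: "visc_subsolution_interior \<Omega> \<Gamma> T P w"
        unfolding w_def
      proof (rule visc_subsolution_interior_bump[OF F_sub \<psi>[of c, unfolded U_def] r])
        show "cball z r \<subseteq> (\<Omega> - \<Gamma>) \<times> {0<..<T}" using cbU by (simp add: U_def)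
        show "snd (H y) + norm (fst (H y)) \<le> P (fst y)" if "y \<in> cball z r" for y
          using near[OF that] by simp
        show "\<psi> c y \<le> F y" if y: "y \<in> cball z r" "r / 2 \<le> dist z y" for y
        proof -
          have "(r / 2)\<^sup>2 \<le> (dist z y)\<^sup>2" using y(2) r by (intro power_mono) auto
          then have "r\<^sup>2 / 4 \<le> inner (y - z) (y - z)"
            by (simp add: dist_norm norm_minus_commute power2_norm_eq_inner power_divide)
          then have "\<psi> c y \<le> E y" using near[OF y(1)] by (simp add: \<psi>_def c_def)
          also have "\<dots> \<le> F y" using EF y(1) cbU U by blast
          finally show ?thesis .
        qed
      qed
      have w_out: "w y = F y" if "y \<notin> U" for y using that cbU by (auto simp: w_def)
      have "w y \<le> h y" if y: "y \<in> K" for y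
      proof (cases "snd y < T")
        case True
        show ?thesis
        proof (rule visc_comparison[OF \<Omega> op P w_sub h(1)])
          show "y \<in> \<Omega> \<times> {0..<T}" using y True by (auto simp: K_def)
          show "w x \<le> h x" if "x \<in> parabolic_boundary \<Omega> \<Gamma> T" for x
          proof -
            have "x \<in> K" "x \<notin> U" using that PK by blast+
            then show ?thesis using w_out[of x] F_h[of x] by simp
          qed
        qed
      next
        case False
        then have "y \<notin> U" by (auto simp: U_def)
        then show ?thesis using w_out F_h y by simp
      qed
      then have "w \<in> S" using w_sub by (simp add: S_def)
      then have wF: "w y \<le> F y" if "y \<in> K" for y using f_ge fF that by fastforce
      have "isCont (\<psi> c) z" using C1_with_gradient_onD[OF \<psi> z] by (rule has_derivative_continuous)
      moreover have "\<psi> c z = E z + r\<^sup>2 / 4" by (simp add: \<psi>_def c_def)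
      ultimately have "\<forall>\<^sub>F y in nhds z. E z + r\<^sup>2 / 8 < \<psi> c y"
        using order_tendstoD(1)[of "\<psi> c" "\<psi> c z" "at z" "E z + r\<^sup>2 / 8"] r
        unfolding eventually_nhds_conv_at by (simp add: continuous_at)
      moreover have "\<forall>\<^sub>F y in nhds z. y \<in> ball z r" using r by (intro eventually_nhds_in_open) auto
      ultimately have "\<forall>\<^sub>F y in nhds z. y \<in> K \<longrightarrow> - F y \<le> - (E z + r\<^sup>2 / 8)"
      proof eventually_elim
        case (elim y)
        then show ?case using wF[of y] by (auto simp: w_def)
      qed
      then have "usc_envelope K (\<lambda>w. - F w) z \<le> - (E z + r\<^sup>2 / 8)"
        using z U by (intro usc_envelope_leI[OF locally_bounded_on_uminus[OF lbF]]) auto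
      then have "E z + r\<^sup>2 / 8 \<le> E z" by (simp add: E_def lsc_envelope_eq_uminus)
      then show False using r by simp
    qed
  qed
  have "F z \<le> E z" if "z \<in> \<Omega> \<times> {0..<T}" for z
  proof (rule visc_comparison[OF \<Omega> op P F_sub E_super _ that])
    fix y assume y: "y \<in> parabolic_boundary \<Omega> \<Gamma> T"
    then have "y \<in> K" using PK by blast
    then show "F y \<le> E y" using F_h[of y] kE[of y] bd[OF y] by simp
  qed
  moreover have "\<Omega> \<times> {0..<T} \<subseteq> K" by (auto simp: K_def)
  ultimately have "F z = E z" if "z \<in> \<Omega> \<times> {0..<T}" for z using EF that by (metis antisym subsetD)
  then show ?thesis using that[OF F_sub E_super] kF F_h K_def by blast
qed

section \<open>Sub- and super-solutions by straight motions\<close>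

text \<open>A one-sided bound along a single ray already constrains the gradient, so barriers without
  derivatives can be treated.\<close>

lemma gradient_direction_ge:
  assumes \<phi>: "GDERIV \<phi> z :> g"
    and ev: "\<forall>\<^sub>F s in at_right 0. \<phi> z - c * s \<le> \<phi> (z + s *\<^sub>R v)"
  shows "- c \<le> inner v g"
proof (rule ccontr)
  assume neg: "\<not> ?thesis"
  have "((\<lambda>s. z + s *\<^sub>R v) has_derivative (\<lambda>s. s *\<^sub>R v)) (at 0)"
    by (auto intro!: derivative_eq_intros)
  moreover have "(\<phi> has_derivative (\<lambda>h. inner h g)) (at (z + 0 *\<^sub>R v))"
    using \<phi> by (simp add: gderiv_def)
  ultimately have "((\<lambda>s. \<phi> (z + s *\<^sub>R v)) has_derivative (\<lambda>s. inner (s *\<^sub>R v) g)) (at 0)"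
    by (rule has_derivative_compose)
  then have "((\<lambda>s. \<phi> (z + s *\<^sub>R v)) has_real_derivative inner v g) (at 0)"
    by (simp add: has_field_derivative_def mult_commute_abs)
  then have "((\<lambda>s. \<phi> (z + s *\<^sub>R v) + c * s) has_real_derivative inner v g + c) (at 0)"
    by (auto intro!: derivative_eq_intros)
  from DERIV_neg_dec_right[OF this] neg obtain d
    where d: "d > 0" "\<And>s. 0 < s \<Longrightarrow> s < d \<Longrightarrow> \<phi> (z + s *\<^sub>R v) + c * s < \<phi> z"
    by auto
  have "\<forall>\<^sub>F s in at_right 0. s \<in> {0<..<d}"
    using d(1) by (rule eventually_at_right_real)
  with ev have "\<forall>\<^sub>F s in at_right (0::real). False"
    by eventually_elim (use d(2) in force)
  then show False by simp
qed

lemma eventually_along_ray: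
  fixes z v :: "'a::real_normed_vector"
  assumes "\<forall>\<^sub>F w in nhds z. Q w"
  shows "\<forall>\<^sub>F s in at_right (0::real). Q (z + s *\<^sub>R v)"
proof -
  have "((\<lambda>s. z + s *\<^sub>R v) \<longlongrightarrow> z + 0 *\<^sub>R v) (at_right 0)" by (intro tendsto_intros)
  then show ?thesis using assms by (auto simp: filterlim_iff)
qed

text \<open>The easy half of dynamic programming: if no motion of speed at most one is cheaper than \<open>k\<close>, then \<open>k\<close>
  is a sub-solution. For a given test function the decisive motion is steepest descent.\<close>

lemma visc_subsolution_interior_of_controls:
  fixes \<Omega> \<Gamma> :: "'a::euclidean_space set"
  assumes op: "open (\<Omega> - \<Gamma>)" and usc: "usc_on (\<Omega> \<times> {0..T}) k"
    and dpp: "\<And>x t v. x \<in> \<Omega> - \<Gamma> \<Longrightarrow> t \<in> {0<..<T} \<Longrightarrow> norm v \<le> 1 \<Longrightarrow>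
      \<forall>\<^sub>F s in at_right 0. k (x, t) \<le> k (x + s *\<^sub>R v, t - s) + P x * s"
  shows "visc_subsolution_interior \<Omega> \<Gamma> T P k"
proof (rule visc_subsolution_interiorI[OF usc])
  let ?U = "(\<Omega> - \<Gamma>) \<times> {0<..<T}"
  fix \<phi> G z
  assume \<phi>: "C1_with_gradient_on ?U \<phi> G" and z: "z \<in> ?U"
    and max: "\<forall>\<^sub>F w in nhds z. w \<in> ?U \<longrightarrow> k w - \<phi> w \<le> k z - \<phi> z"
  define v where "v = (- sgn (fst (G z)), - 1 :: real)"
  have "\<forall>\<^sub>F w in nhds z. w \<in> ?U"
    using z op by (intro eventually_nhds_in_open open_Times) auto
  with max have "\<forall>\<^sub>F w in nhds z. k w - \<phi> w \<le> k z - \<phi> z" by eventually_elim auto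
  from eventually_along_ray[OF this]
  have "\<forall>\<^sub>F s in at_right 0. k (z + s *\<^sub>R v) - \<phi> (z + s *\<^sub>R v) \<le> k z - \<phi> z" .
  moreover have "\<forall>\<^sub>F s in at_right 0. k z \<le> k (z + s *\<^sub>R v) + P (fst z) * s"
    using dpp[of "fst z" "snd z" "- sgn (fst (G z))"] z
    by (cases z) (auto simp: v_def norm_sgn)
  ultimately have "\<forall>\<^sub>F s in at_right 0. \<phi> z - P (fst z) * s \<le> \<phi> (z + s *\<^sub>R v)"
    by eventually_elim linarith
  then have "- P (fst z) \<le> inner v (G z)"
    using \<phi> z unfolding C1_with_gradient_on_def by (blast intro: gradient_direction_ge)
  moreover have "inner (sgn (fst (G z))) (fst (G z)) = norm (fst (G z))"
    by (cases "fst (G z) = 0")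
      (simp_all add: sgn_div_norm power2_norm_eq_inner[symmetric] power2_eq_square)
  ultimately show "snd (G z) + norm (fst (G z)) \<le> P (fst z)"
    by (simp add: v_def inner_prod_def)
qed

text \<open>The other half: one motion that costs no more than \<open>k\<close> promises is enough for a super-solution.\<close>

lemma visc_supersolution_interior_of_control:
  fixes \<Omega> \<Gamma> :: "'a::euclidean_space set"
  assumes op: "open (\<Omega> - \<Gamma>)" and lsc: "lsc_on (\<Omega> \<times> {0..T}) k"
    and dpp: "\<And>x t. x \<in> \<Omega> - \<Gamma> \<Longrightarrow> t \<in> {0<..<T} \<Longrightarrow>
      \<exists>v. norm v \<le> 1 \<and> (\<forall>\<^sub>F s in at_right 0. k (x + s *\<^sub>R v, t - s) + P x * s \<le> k (x, t))"
  shows "visc_supersolution_interior \<Omega> \<Gamma> T P k"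
proof (rule visc_supersolution_interiorI[OF lsc])
  let ?U = "(\<Omega> - \<Gamma>) \<times> {0<..<T}"
  fix \<phi> G z
  assume \<phi>: "C1_with_gradient_on ?U \<phi> G" and z: "z \<in> ?U"
    and min: "\<forall>\<^sub>F w in nhds z. w \<in> ?U \<longrightarrow> k z - \<phi> z \<le> k w - \<phi> w"
  obtain e where e: "norm e \<le> 1"
      "\<forall>\<^sub>F s in at_right 0. k (fst z + s *\<^sub>R e, snd z - s) + P (fst z) * s \<le> k (fst z, snd z)"
    using dpp[of "fst z" "snd z"] z by auto
  define v where "v = (e, - 1 :: real)"
  have "\<forall>\<^sub>F w in nhds z. w \<in> ?U"
    using z op by (intro eventually_nhds_in_open open_Times) auto
  with min have "\<forall>\<^sub>F w in nhds z. k z - \<phi> z \<le> k w - \<phi> w" by eventually_elim auto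
  from eventually_along_ray[OF this]
  have "\<forall>\<^sub>F s in at_right 0. k z - \<phi> z \<le> k (z + s *\<^sub>R v) - \<phi> (z + s *\<^sub>R v)" .
  moreover have "\<forall>\<^sub>F s in at_right 0. k (z + s *\<^sub>R v) + P (fst z) * s \<le> k z"
    using e(2) by (cases z) (auto simp: v_def)
  ultimately have "\<forall>\<^sub>F s in at_right 0. - \<phi> z - (- P (fst z)) * s \<le> - \<phi> (z + s *\<^sub>R v)"
    by eventually_elim linarith
  moreover have "GDERIV (\<lambda>w. - \<phi> w) z :> - G z"
    using \<phi> z unfolding C1_with_gradient_on_def by (blast intro: GDERIV_minus)
  ultimately have "P (fst z) \<le> - inner v (G z)"
    using gradient_direction_ge by fastforce
  moreover have "inner v (G z) = inner e (fst (G z)) - snd (G z)" by (simp add: v_def inner_prod_def)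
  moreover have "- inner e (fst (G z)) \<le> norm e * norm (fst (G z))"
    using norm_cauchy_schwarz[of "- e" "fst (G z)"] by simp
  moreover have "norm e * norm (fst (G z)) \<le> 1 * norm (fst (G z))"
    using e(1) by (intro mult_right_mono) auto
  ultimately show "P (fst z) \<le> snd (G z) + norm (fst (G z))" by simp
qed

section \<open>Changing the time horizon\<close>

lemma visc_subsolution_interior_cong:
  assumes "\<And>z. z \<in> \<Omega> \<times> {0..T} \<Longrightarrow> f z = g z" and "visc_subsolution_interior \<Omega> \<Gamma> T P f"
  shows "visc_subsolution_interior \<Omega> \<Gamma> T P g"
proof (rule visc_subsolution_interiorI)
  show "usc_on (\<Omega> \<times> {0..T}) g"
    using usc_on_cong[of "\<Omega> \<times> {0..T}" f g] assms(1) visc_subsolution_interior_usc[OF assms(2)] by blast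
next
  let ?U = "(\<Omega> - \<Gamma>) \<times> {0<..<T}"
  fix \<phi> G z
  assume \<phi>: "C1_with_gradient_on ?U \<phi> G" and z: "z \<in> ?U"
    and max: "\<forall>\<^sub>F w in nhds z. w \<in> ?U \<longrightarrow> g w - \<phi> w \<le> g z - \<phi> z"
  have eq: "f w = g w" if "w \<in> ?U" for w using that by (intro assms(1)) auto
  have "\<forall>\<^sub>F w in nhds z. w \<in> ?U \<longrightarrow> f w - \<phi> w \<le> f z - \<phi> z"
    using max by eventually_elim (use eq z in simp)
  then show "snd (G z) + norm (fst (G z)) \<le> P (fst z)"
    by (rule visc_subsolution_interiorD[OF assms(2) \<phi> z])
qed

lemma visc_supersolution_interior_cong:
  assumes "\<And>z. z \<in> \<Omega> \<times> {0..T} \<Longrightarrow> f z = g z" and "visc_supersolution_interior \<Omega> \<Gamma> T P f"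
  shows "visc_supersolution_interior \<Omega> \<Gamma> T P g"
proof (rule visc_supersolution_interiorI)
  show "lsc_on (\<Omega> \<times> {0..T}) g"
    using lsc_on_cong[of "\<Omega> \<times> {0..T}" f g] assms(1) visc_supersolution_interior_lsc[OF assms(2)] by blast
next
  let ?U = "(\<Omega> - \<Gamma>) \<times> {0<..<T}"
  fix \<phi> G z
  assume \<phi>: "C1_with_gradient_on ?U \<phi> G" and z: "z \<in> ?U"
    and min: "\<forall>\<^sub>F w in nhds z. w \<in> ?U \<longrightarrow> g z - \<phi> z \<le> g w - \<phi> w"
  have eq: "f w = g w" if "w \<in> ?U" for w using that by (intro assms(1)) auto
  have "\<forall>\<^sub>F w in nhds z. w \<in> ?U \<longrightarrow> f z - \<phi> z \<le> f w - \<phi> w"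
    using min by eventually_elim (use eq z in simp)
  then show "P (fst z) \<le> snd (G z) + norm (fst (G z))"
    by (rule visc_supersolution_interiorD[OF assms(2) \<phi> z])
qed

text \<open>Since \<open>z\<close> lies strictly before \<open>T\<close>, the clock can be chosen to show the true time around \<open>z\<close>.\<close>

lemma extend_test_function:
  fixes \<phi> :: "'a::real_inner \<times> real \<Rightarrow> real" and T T' :: real
  assumes \<phi>: "C1_with_gradient_on (D \<times> {0<..<T}) \<phi> G" and z: "z \<in> D \<times> {0<..<T}"
  obtains \<eta> H where "C1_with_gradient_on (D \<times> {0<..<T'}) \<eta> H" "H z = G z"
    "\<forall>\<^sub>F w in nhds z. \<eta> w = \<phi> w"
proof -
  define s where "s = (snd z + T) / 2"
  have s: "0 < s" "s < T" "snd z < s" using z by (auto simp: s_def)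
  obtain \<theta> \<theta>' where \<theta>: "\<And>t. t \<in> {0<..<T'} \<Longrightarrow> \<theta> t \<in> {0<..<T} \<and> (\<theta> has_real_derivative \<theta>' t) (at t)"
      "continuous_on {0<..<T'} \<theta>'"
      and id: "\<And>t. t \<le> s \<Longrightarrow> \<theta> t = t" "\<And>t. t \<le> s \<Longrightarrow> \<theta>' t = 1"
    using saturating_clock[OF s(1,2), of T'] by metis
  have "\<forall>\<^sub>F w in nhds z. w \<in> UNIV \<times> {..<s}"
    by (rule eventually_nhds_in_open) (use s in \<open>auto intro: open_Times simp: mem_Times_iff\<close>)
  then have "\<forall>\<^sub>F w in nhds z. \<phi> (fst w, \<theta> (snd w)) = \<phi> w"
    by eventually_elim (auto simp: id)
  moreover have "(fst (G (fst z, \<theta> (snd z))), \<theta>' (snd z) * snd (G (fst z, \<theta> (snd z)))) = G z"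
    using s id by simp
  ultimately show ?thesis
    using that C1_with_gradient_on_time_change[OF \<phi> \<theta>] by blast
qed

lemma visc_subsolution_interior_restrict:
  assumes f: "visc_subsolution_interior \<Omega> \<Gamma> T' P f" and "T \<le> T'"
  shows "visc_subsolution_interior \<Omega> \<Gamma> T P f"
proof (rule visc_subsolution_interiorI)
  show "usc_on (\<Omega> \<times> {0..T}) f"
    using visc_subsolution_interior_usc[OF f] \<open>T \<le> T'\<close> by (auto intro: usc_on_subset)
next
  let ?U = "(\<Omega> - \<Gamma>) \<times> {0<..<T}" and ?U' = "(\<Omega> - \<Gamma>) \<times> {0<..<T'}"
  fix \<phi> G z
  assume \<phi>: "C1_with_gradient_on ?U \<phi> G" and z: "z \<in> ?U"
    and max: "\<forall>\<^sub>F w in nhds z. w \<in> ?U \<longrightarrow> f w - \<phi> w \<le> f z - \<phi> z"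
  obtain \<eta> H where \<eta>: "C1_with_gradient_on ?U' \<eta> H" and H: "H z = G z"
    and eq: "\<forall>\<^sub>F w in nhds z. \<eta> w = \<phi> w"
    using extend_test_function[OF \<phi> z] by metis
  have "\<forall>\<^sub>F w in nhds z. w \<in> UNIV \<times> {..<T}"
    by (rule eventually_nhds_in_open) (use z in \<open>auto intro: open_Times simp: mem_Times_iff\<close>)
  then have "\<forall>\<^sub>F w in nhds z. w \<in> ?U' \<longrightarrow> f w - \<eta> w \<le> f z - \<eta> z"
    using max eq by eventually_elim (use eventually_nhds_x_imp_x[OF eq] in auto)
  then show "snd (G z) + norm (fst (G z)) \<le> P (fst z)"
    using visc_subsolution_interiorD[OF f \<eta>, of z] z \<open>T \<le> T'\<close> H by auto
qed

lemma visc_supersolution_interior_restrict: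
  assumes f: "visc_supersolution_interior \<Omega> \<Gamma> T' P f" and "T \<le> T'"
  shows "visc_supersolution_interior \<Omega> \<Gamma> T P f"
proof (rule visc_supersolution_interiorI)
  show "lsc_on (\<Omega> \<times> {0..T}) f"
    using visc_supersolution_interior_lsc[OF f] \<open>T \<le> T'\<close> by (auto intro: lsc_on_subset)
next
  let ?U = "(\<Omega> - \<Gamma>) \<times> {0<..<T}" and ?U' = "(\<Omega> - \<Gamma>) \<times> {0<..<T'}"
  fix \<phi> G z
  assume \<phi>: "C1_with_gradient_on ?U \<phi> G" and z: "z \<in> ?U"
    and min: "\<forall>\<^sub>F w in nhds z. w \<in> ?U \<longrightarrow> f z - \<phi> z \<le> f w - \<phi> w"
  obtain \<eta> H where \<eta>: "C1_with_gradient_on ?U' \<eta> H" and H: "H z = G z"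
    and eq: "\<forall>\<^sub>F w in nhds z. \<eta> w = \<phi> w"
    using extend_test_function[OF \<phi> z] by metis
  have "\<forall>\<^sub>F w in nhds z. w \<in> UNIV \<times> {..<T}"
    by (rule eventually_nhds_in_open) (use z in \<open>auto intro: open_Times simp: mem_Times_iff\<close>)
  then have "\<forall>\<^sub>F w in nhds z. w \<in> ?U' \<longrightarrow> f z - \<eta> z \<le> f w - \<eta> w"
    using min eq by eventually_elim (use eventually_nhds_x_imp_x[OF eq] in auto)
  then show "P (fst z) \<le> snd (G z) + norm (fst (G z))"
    using visc_supersolution_interiorD[OF f \<eta>, of z] z \<open>T \<le> T'\<close> H by auto
qed

text \<open>Rescaling time multiplies the time derivative of a test function by a constant, but that derivative
  vanishes where the test function touches a stationary function from above.\<close>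

lemma stationary_visc_subsolution_interior_time:
  fixes \<Omega> \<Gamma> :: "'a::euclidean_space set"
  assumes k: "visc_subsolution_interior \<Omega> \<Gamma> T P (\<lambda>(x, t). k x)" and cont: "continuous_on \<Omega> k"
    and op: "open (\<Omega> - \<Gamma>)" and T: "0 < T" "0 < T'"
  shows "visc_subsolution_interior \<Omega> \<Gamma> T' P (\<lambda>(x, t). k x)"
proof (rule visc_subsolution_interiorI)
  have "continuous_on (\<Omega> \<times> {0..T'}) (\<lambda>z. k (fst z))"
    by (rule continuous_on_compose2[OF cont]) (auto intro!: continuous_intros)
  then show "usc_on (\<Omega> \<times> {0..T'}) (\<lambda>(x, t). k x)"
    by (simp add: continuous_on_iff_usc_lsc case_prod_beta')
next
  let ?U = "(\<Omega> - \<Gamma>) \<times> {0<..<T}" and ?U' = "(\<Omega> - \<Gamma>) \<times> {0<..<T'}"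
  fix \<phi> G z
  assume \<phi>: "C1_with_gradient_on ?U' \<phi> G" and z: "z \<in> ?U'"
    and max': "\<forall>\<^sub>F w in nhds z. w \<in> ?U' \<longrightarrow>
      (case w of (x, t) \<Rightarrow> k x) - \<phi> w \<le> (case z of (x, t) \<Rightarrow> k x) - \<phi> z"
  have "\<forall>\<^sub>F w in nhds z. w \<in> ?U'"
    using z op by (intro eventually_nhds_in_open open_Times) auto
  with max' have max: "\<forall>\<^sub>F w in nhds z. k (fst w) - \<phi> w \<le> k (fst z) - \<phi> z"
    unfolding case_prod_beta' by eventually_elim blast
  have dG: "GDERIV \<phi> z :> G z" using \<phi> z unfolding C1_with_gradient_on_def by blast
  have flat: "0 \<le> inner (0, a) (G z)" for a :: real
  proof -
    have "\<forall>\<^sub>F s in at_right 0. \<phi> z - 0 * s \<le> \<phi> (z + s *\<^sub>R (0, a))"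
      using eventually_along_ray[OF max, of "(0, a)"] by eventually_elim simp
    from gradient_direction_ge[OF dG this] show ?thesis by simp
  qed
  have G0: "snd (G z) = 0" using flat[of 1] flat[of "- 1"] by (simp add: inner_prod_def)
  define c where "c = T' / T"
  have c: "c > 0" using T by (simp add: c_def)
  define y where "y = (fst z, snd z / c)"
  have y: "y \<in> ?U" using z T by (auto simp: y_def c_def field_simps)
  have \<theta>: "c * t \<in> {0<..<T'} \<and> ((\<lambda>t. c * t) has_real_derivative c) (at t)"
    if "t \<in> {0<..<T}" for t
    using that T by (auto simp: c_def field_simps intro!: derivative_eq_intros)
  have yz: "(fst y, c * snd y) = z" using c by (simp add: y_def)
  have "((\<lambda>w. (fst w, c * snd w)) \<longlongrightarrow> (fst y, c * snd y)) (nhds y)"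
    by (intro tendsto_intros filterlim_ident)
  then have "\<forall>\<^sub>F w in nhds y. k (fst w) - \<phi> (fst w, c * snd w) \<le> k (fst z) - \<phi> z"
    using max eventually_compose_filterlim[of _ "nhds z" "\<lambda>w. (fst w, c * snd w)" "nhds y"]
    unfolding yz by fastforce
  then have "\<forall>\<^sub>F w in nhds y. w \<in> ?U \<longrightarrow>
      (case w of (x, t) \<Rightarrow> k x) - \<phi> (fst w, c * snd w) \<le> (case y of (x, t) \<Rightarrow> k x) - \<phi> (fst y, c * snd y)"
    unfolding yz by eventually_elim (auto simp: y_def case_prod_beta')
  from visc_subsolution_interiorD[OF k C1_with_gradient_on_time_change[OF \<phi> \<theta> continuous_on_const] y this]
  show "snd (G z) + norm (fst (G z)) \<le> P (fst z)"
    unfolding yz by (simp add: G0 y_def)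
qed

section \<open>Lipschitz constants, supremum norms and barriers\<close>

lemma lipschitz_on_lip_const:
  assumes "L-lipschitz_on S h"
  shows "(lip_const S h)-lipschitz_on S h"
proof (rule lipschitz_onI)
  let ?A = "{L. L-lipschitz_on S h}"
  have ne: "?A \<noteq> {}" using assms by blast
  show "0 \<le> lip_const S h"
    unfolding lip_const_def using ne by (rule cInf_greatest) (auto dest: lipschitz_on_nonneg)
  fix x y assume xy: "x \<in> S" "y \<in> S"
  show "dist (h x) (h y) \<le> lip_const S h * dist x y"
  proof (cases "x = y")
    case False
    have "dist (h x) (h y) / dist x y \<le> lip_const S h"
      unfolding lip_const_def using ne
    proof (rule cInf_greatest)
      fix C assume "C \<in> ?A"
      then have "dist (h x) (h y) \<le> C * dist x y" using xy by (auto dest: lipschitz_onD)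
      then show "dist (h x) (h y) / dist x y \<le> C" using False by (simp add: field_simps)
    qed
    then show ?thesis using False by (simp add: field_simps)
  qed simp
qed

lemma abs_le_sup_norm_on:
  assumes "bounded (h ` S)" "x \<in> S"
  shows "\<bar>h x\<bar> \<le> sup_norm_on S h"
proof -
  obtain B where "\<forall>y\<in>h ` S. norm y \<le> B" using assms(1) unfolding bounded_iff by blast
  then have "bdd_above ((\<lambda>x. \<bar>h x\<bar>) ` S)" by (auto intro!: bdd_aboveI2[of _ _ B])
  then have "\<bar>h x\<bar> \<le> (SUP x\<in>S. \<bar>h x\<bar>)" using assms(2) by (intro cSUP_upper)
  then show ?thesis using assms(2) by (auto simp: sup_norm_on_def)
qed

lemma sup_norm_on_nonneg:
  assumes "bounded (h ` S)"
  shows "0 \<le> sup_norm_on S h"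
proof (cases "S = {}")
  case False
  then obtain x where "x \<in> S" by blast
  from abs_le_sup_norm_on[OF assms this] show ?thesis using abs_ge_zero[of "h x"] by linarith
qed (simp add: sup_norm_on_def)

text \<open>The McShane extension of \<open>\<psi>\<close> from \<open>\<Gamma>\<close>: the largest \<open>C\<close>-Lipschitz function that agrees with
  \<open>\<psi>\<close> on \<open>\<Gamma>\<close>, if \<open>\<psi>\<close> is \<open>C\<close>-Lipschitz there.\<close>

definition lip_upper_extension :: "'a::metric_space set \<Rightarrow> ('a \<Rightarrow> real) \<Rightarrow> real \<Rightarrow> 'a \<Rightarrow> real" where
  "lip_upper_extension \<Gamma> \<psi> C x = (INF y\<in>\<Gamma>. \<psi> y + C * dist x y)"

context
  fixes \<Gamma> :: "'a::metric_space set" and \<psi> :: "'a \<Rightarrow> real" and C :: real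
  assumes compact: "compact \<Gamma>" and nonempty: "\<Gamma> \<noteq> {}" and lip: "C-lipschitz_on \<Gamma> \<psi>"
begin

lemma lip_upper_extension_le: "y \<in> \<Gamma> \<Longrightarrow> lip_upper_extension \<Gamma> \<psi> C x \<le> \<psi> y + C * dist x y"
  unfolding lip_upper_extension_def
proof (rule cINF_lower)
  have "bounded (\<psi> ` \<Gamma>)"
    using compact lip
    by (intro compact_imp_bounded compact_continuous_image lipschitz_on_continuous_on)
  then obtain B where B: "\<forall>y\<in>\<psi> ` \<Gamma>. norm y \<le> B" unfolding bounded_iff by blast
  have "- B \<le> \<psi> y + C * dist x y" if "y \<in> \<Gamma>" for y
  proof -
    have "- B \<le> \<psi> y" using B that by force
    then show ?thesis using lipschitz_on_nonneg[OF lip] by (simp add: add_increasing2)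
  qed
  then show "bdd_below ((\<lambda>y. \<psi> y + C * dist x y) ` \<Gamma>)" by (rule bdd_belowI2)
qed

lemma lip_upper_extension_attained:
  obtains y where "y \<in> \<Gamma>" "lip_upper_extension \<Gamma> \<psi> C x = \<psi> y + C * dist x y"
proof -
  have "continuous_on \<Gamma> (\<lambda>y. \<psi> y + C * dist x y)"
    using lip by (intro continuous_intros lipschitz_on_continuous_on)
  then obtain y where y: "y \<in> \<Gamma>" "\<And>w. w \<in> \<Gamma> \<Longrightarrow> \<psi> y + C * dist x y \<le> \<psi> w + C * dist x w"
    using continuous_attains_inf[OF compact nonempty] by blast
  have "\<psi> y + C * dist x y \<le> lip_upper_extension \<Gamma> \<psi> C x"
    unfolding lip_upper_extension_def using nonempty y(2) by (rule cINF_greatest)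
  with lip_upper_extension_le[OF y(1), of x] y(1) show ?thesis by (intro that) auto
qed

lemma lipschitz_on_lip_upper_extension: "C-lipschitz_on S (lip_upper_extension \<Gamma> \<psi> C)"
proof (rule lipschitz_onI[OF _ lipschitz_on_nonneg[OF lip]])
  have le: "lip_upper_extension \<Gamma> \<psi> C x \<le> lip_upper_extension \<Gamma> \<psi> C x' + C * dist x x'" for x x'
  proof -
    obtain y where y: "y \<in> \<Gamma>" "lip_upper_extension \<Gamma> \<psi> C x' = \<psi> y + C * dist x' y"
      by (rule lip_upper_extension_attained)
    have "C * dist x y \<le> C * (dist x x' + dist x' y)"
      using lipschitz_on_nonneg[OF lip] by (intro mult_left_mono dist_triangle)
    then show ?thesis using lip_upper_extension_le[OF y(1), of x] y(2) by (simp add: distrib_left)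
  qed
  show "dist (lip_upper_extension \<Gamma> \<psi> C x) (lip_upper_extension \<Gamma> \<psi> C x') \<le> C * dist x x'" for x x'
    using le[of x x'] le[of x' x] by (simp add: dist_real_def dist_commute abs_le_iff)
qed

lemma le_lip_upper_extension:
  assumes "C-lipschitz_on S \<psi>" "\<Gamma> \<subseteq> S" "x \<in> S"
  shows "\<psi> x \<le> lip_upper_extension \<Gamma> \<psi> C x"
proof -
  obtain y where y: "y \<in> \<Gamma>" "lip_upper_extension \<Gamma> \<psi> C x = \<psi> y + C * dist x y"
    by (rule lip_upper_extension_attained)
  then show ?thesis
    using lipschitz_onD[OF assms(1), of x y] assms by (auto simp: dist_real_def)
qed

lemma lip_upper_extension_eq: "x \<in> \<Gamma> \<Longrightarrow> lip_upper_extension \<Gamma> \<psi> C x = \<psi> x"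
  using lip_upper_extension_le[of x x] le_lip_upper_extension[OF lip] by force

end

text \<open>Moving straight towards a foot point \<open>y\<close> at which the infimum is attained lowers the extension at
  rate \<open>C\<close>, which pays for the running cost \<open>P\<close>.\<close>

lemma lip_upper_extension_visc_supersolution_interior:
  fixes \<Omega> \<Gamma> :: "'a::euclidean_space set"
  assumes \<Gamma>: "compact \<Gamma>" "\<Gamma> \<noteq> {}" and lip: "C-lipschitz_on \<Gamma> \<psi>"
    and op: "open (\<Omega> - \<Gamma>)" and P: "\<And>x. x \<in> \<Omega> - \<Gamma> \<Longrightarrow> P x \<le> C"
  shows "visc_supersolution_interior \<Omega> \<Gamma> T P (\<lambda>z. lip_upper_extension \<Gamma> \<psi> C (fst z))"
proof (rule visc_supersolution_interior_of_control[OF op])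
  let ?h = "lip_upper_extension \<Gamma> \<psi> C"
  have "continuous_on (\<Omega> \<times> {0..T}) (\<lambda>z. ?h (fst z))"
    by (rule continuous_on_compose2[OF lipschitz_on_continuous_on[OF
            lipschitz_on_lip_upper_extension[OF \<Gamma> lip, of UNIV]]]) (auto intro!: continuous_intros)
  then show "lsc_on (\<Omega> \<times> {0..T}) (\<lambda>z. ?h (fst z))" by (simp add: continuous_on_iff_usc_lsc)
  fix x t assume x: "x \<in> \<Omega> - \<Gamma>"
  obtain y where y: "y \<in> \<Gamma>" "?h x = \<psi> y + C * dist x y"
    by (rule lip_upper_extension_attained[OF \<Gamma> lip])
  have d: "dist x y > 0" using x y by auto
  define v where "v = sgn (y - x)"
  have v: "norm v \<le> 1" "y - x = dist x y *\<^sub>R v"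
    using d by (auto simp: v_def norm_sgn sgn_div_norm dist_norm norm_minus_commute)
  have "?h (x + s *\<^sub>R v) + P x * s \<le> ?h x" if s: "s \<in> {0<..<dist x y}" for s
  proof -
    have "x + s *\<^sub>R v - y = (s - dist x y) *\<^sub>R v" using v(2) by (simp add: algebra_simps)
    then have "dist (x + s *\<^sub>R v) y \<le> dist x y - s"
      using s v(1) by (simp add: dist_norm[of "x + s *\<^sub>R v"] mult_left_le)
    then have "C * dist (x + s *\<^sub>R v) y \<le> C * (dist x y - s)"
      using lipschitz_on_nonneg[OF lip] by (intro mult_left_mono)
    moreover have "P x * s \<le> C * s" using P[OF x] s by (intro mult_right_mono) auto
    ultimately show ?thesis
      using lip_upper_extension_le[OF \<Gamma> lip y(1), of "x + s *\<^sub>R v"] y(2)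
      by (simp add: algebra_simps)
  qed
  then have "\<forall>\<^sub>F s in at_right 0. ?h (x + s *\<^sub>R v) + P x * s \<le> ?h x"
    using eventually_at_right_real[OF d] by (auto elim: eventually_mono)
  then show "\<exists>v. norm v \<le> 1 \<and>
      (\<forall>\<^sub>F s in at_right 0. ?h (fst (x + s *\<^sub>R v, t - s)) + P x * s \<le> ?h (fst (x, t)))"
    using v(1) by auto
qed

text \<open>Staying at \<open>x\<close> costs at most \<open>M\<close> per unit of time.\<close>

lemma visc_supersolution_interior_growth:
  fixes \<Omega> \<Gamma> :: "'a::euclidean_space set"
  assumes op: "open (\<Omega> - \<Gamma>)" and \<psi>: "continuous_on \<Omega> \<psi>" and P: "\<And>x. x \<in> \<Omega> - \<Gamma> \<Longrightarrow> P x \<le> M"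
  shows "visc_supersolution_interior \<Omega> \<Gamma> T P (\<lambda>z. \<psi> (fst z) + M * snd z)"
proof (rule visc_supersolution_interior_of_control[OF op])
  have "continuous_on (\<Omega> \<times> {0..T}) (\<lambda>z. \<psi> (fst z))"
    by (rule continuous_on_compose2[OF \<psi>]) (auto intro!: continuous_intros)
  then have "continuous_on (\<Omega> \<times> {0..T}) (\<lambda>z. \<psi> (fst z) + M * snd z)" by (intro continuous_intros)
  then show "lsc_on (\<Omega> \<times> {0..T}) (\<lambda>z. \<psi> (fst z) + M * snd z)"
    by (simp add: continuous_on_iff_usc_lsc)
  fix x t assume x: "x \<in> \<Omega> - \<Gamma>"
  have "\<forall>\<^sub>F s in at_right 0. s > (0::real)" by (rule eventually_at_right_less)
  then have "\<forall>\<^sub>F s in at_right 0. \<psi> x + M * (t - s) + P x * s \<le> \<psi> x + M * t"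
    by eventually_elim (use P[OF x] in \<open>simp add: algebra_simps mult_right_mono\<close>)
  then show "\<exists>v. norm v \<le> 1 \<and> (\<forall>\<^sub>F s in at_right 0.
      \<psi> (fst (x + s *\<^sub>R v, t - s)) + M * snd (x + s *\<^sub>R v, t - s) + P x * s
      \<le> \<psi> (fst (x, t)) + M * snd (x, t))"
    by (intro exI[of _ 0]) simp
qed

text \<open>Within time \<open>s\<close> a motion of speed at most one changes \<open>\<psi>\<close> by at most \<open>L * s\<close>, which the decaying term
  compensates.\<close>

lemma visc_subsolution_interior_decay:
  fixes \<Omega> \<Gamma> :: "'a::euclidean_space set"
  assumes op: "open (\<Omega> - \<Gamma>)" and \<psi>: "L-lipschitz_on \<Omega> \<psi>"
    and P: "\<And>x. x \<in> \<Omega> - \<Gamma> \<Longrightarrow> 0 \<le> P x"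
  shows "visc_subsolution_interior \<Omega> \<Gamma> T P (\<lambda>z. \<psi> (fst z) - L * snd z)"
proof (rule visc_subsolution_interior_of_controls[OF op])
  have "continuous_on (\<Omega> \<times> {0..T}) (\<lambda>z. \<psi> (fst z))"
    by (rule continuous_on_compose2[OF lipschitz_on_continuous_on[OF \<psi>]])
      (auto intro!: continuous_intros)
  then have "continuous_on (\<Omega> \<times> {0..T}) (\<lambda>z. \<psi> (fst z) - L * snd z)" by (intro continuous_intros)
  then show "usc_on (\<Omega> \<times> {0..T}) (\<lambda>z. \<psi> (fst z) - L * snd z)"
    by (simp add: continuous_on_iff_usc_lsc)
  fix x t and v :: 'a assume x: "x \<in> \<Omega> - \<Gamma>" and v: "norm v \<le> 1"
  have "\<forall>\<^sub>F w in nhds x. w \<in> \<Omega> - \<Gamma>" using op x by (rule eventually_nhds_in_open)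
  then have "\<forall>\<^sub>F s in at_right 0. x + s *\<^sub>R v \<in> \<Omega> - \<Gamma>" by (rule eventually_along_ray)
  moreover have "\<forall>\<^sub>F s in at_right 0. s > (0::real)" by (rule eventually_at_right_less)
  ultimately show "\<forall>\<^sub>F s in at_right 0. \<psi> (fst (x, t)) - L * snd (x, t)
      \<le> \<psi> (fst (x + s *\<^sub>R v, t - s)) - L * snd (x + s *\<^sub>R v, t - s) + P x * s"
  proof eventually_elim
    case (elim s)
    have "\<bar>\<psi> x - \<psi> (x + s *\<^sub>R v)\<bar> \<le> L * dist x (x + s *\<^sub>R v)"
      using lipschitz_onD[OF \<psi>, of x "x + s *\<^sub>R v"] x elim by (auto simp: dist_real_def)
    also have "\<dots> \<le> L * s"
      using lipschitz_on_nonneg[OF \<psi>] elim(2) v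
      by (intro mult_left_mono) (auto simp: dist_norm mult_left_le)
    finally have "\<psi> x - \<psi> (x + s *\<^sub>R v) \<le> L * s" by simp
    moreover have "0 \<le> P x * s" using P[OF x] elim(2) by simp
    ultimately show ?case by (simp add: algebra_simps)
  qed
qed

section \<open>Existence and uniqueness\<close>

lemma visc_solution_of_continuous:
  assumes cont: "continuous_on (\<Omega> \<times> {0..T}) f" and \<Omega>: "compact \<Omega>" and T: "0 < T" and \<Gamma>: "\<Gamma> \<subseteq> \<Omega>"
    and sub: "visc_subsolution_interior \<Omega> \<Gamma> T P f" and super: "visc_supersolution_interior \<Omega> \<Gamma> T P f"
    and bd: "\<And>z. z \<in> parabolic_boundary \<Omega> \<Gamma> T \<Longrightarrow> f z = \<psi> (fst z)"
  shows "visc_solution \<Omega> \<Gamma> T P \<psi> f"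
proof -
  let ?K = "\<Omega> \<times> {0..T}"
  have lb: "locally_bounded_on ?K f"
    using \<Omega> cont
    by (intro locally_bounded_on_bounded compact_imp_bounded compact_continuous_image compact_Times) auto
  have upper: "f z = usc_envelope ?K f z" and lower: "f z = lsc_envelope ?K f z" if "z \<in> ?K" for z
    using cont that usc_envelope_eq_of_usc[OF lb] lsc_envelope_eq_of_lsc[OF lb]
    by (simp_all add: continuous_on_iff_usc_lsc)
  have PK: "parabolic_boundary \<Omega> \<Gamma> T \<subseteq> ?K"
    using \<Gamma> T by (auto simp: parabolic_boundary_def)
  have "usc_envelope ?K f (x, t) = \<psi> x" "lsc_envelope ?K f (x, t) = \<psi> x"
    if "(x, t) \<in> parabolic_boundary \<Omega> \<Gamma> T" for x t
    using upper[of "(x, t)"] lower[of "(x, t)"] PK bd[OF that] that by auto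
  then have "\<forall>(x, t)\<in>parabolic_boundary \<Omega> \<Gamma> T. usc_envelope ?K f (x, t) \<le> \<psi> x"
    "\<forall>(x, t)\<in>parabolic_boundary \<Omega> \<Gamma> T. lsc_envelope ?K f (x, t) \<ge> \<psi> x"
    by auto
  then show ?thesis
    unfolding visc_solution_def visc_subsolution_def visc_supersolution_def
    using lb visc_subsolution_interior_cong[OF upper sub] visc_supersolution_interior_cong[OF lower super]
    by blast
qed

text \<open>The envelopes of \<open>g\<close> are squeezed onto \<open>f\<close> by comparing each of them with \<open>f\<close>, and \<open>g\<close> lies
  between its envelopes.\<close>

lemma visc_solution_unique:
  fixes \<Omega> \<Gamma> :: "'a::euclidean_space set"
  assumes \<Omega>: "compact \<Omega>" and op: "open (\<Omega> - \<Gamma>)" and P: "L-lipschitz_on (\<Omega> - \<Gamma>) P"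
    and sub: "visc_subsolution_interior \<Omega> \<Gamma> T P f" and super: "visc_supersolution_interior \<Omega> \<Gamma> T P f"
    and bd: "\<And>z. z \<in> parabolic_boundary \<Omega> \<Gamma> T \<Longrightarrow> f z = \<psi> (fst z)"
    and g: "visc_solution \<Omega> \<Gamma> T P \<psi> g" and z: "z \<in> \<Omega> \<times> {0..<T}"
  shows "g z = f z"
proof (rule antisym)
  let ?K = "\<Omega> \<times> {0..T}"
  have lb: "locally_bounded_on ?K g"
    and g_sub: "visc_subsolution_interior \<Omega> \<Gamma> T P (usc_envelope ?K g)"
    and g_super: "visc_supersolution_interior \<Omega> \<Gamma> T P (lsc_envelope ?K g)"
    and g_bd: "\<And>z. z \<in> parabolic_boundary \<Omega> \<Gamma> T \<Longrightarrow>
      usc_envelope ?K g z \<le> \<psi> (fst z) \<and> \<psi> (fst z) \<le> lsc_envelope ?K g z"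
    using g unfolding visc_solution_def visc_subsolution_def visc_supersolution_def by auto
  have zK: "z \<in> ?K" using z by auto
  have "g z \<le> usc_envelope ?K g z" by (rule le_usc_envelope[OF lb zK])
  also have "\<dots> \<le> f z"
    by (rule visc_comparison[OF \<Omega> op P g_sub super _ z]) (use g_bd bd in auto)
  finally show "g z \<le> f z" .
  have "f z \<le> lsc_envelope ?K g z"
    by (rule visc_comparison[OF \<Omega> op P sub g_super _ z]) (use g_bd bd in auto)
  also have "\<dots> \<le> g z" by (rule lsc_envelope_le[OF lb zK])
  finally show "f z \<le> g z" .
qed

lemma continuous_on_eq_at_final_time:
  fixes f g :: "'a::topological_space \<times> real \<Rightarrow> 'b::t2_space"
  assumes "continuous_on (\<Omega> \<times> {0..T}) f" "continuous_on (\<Omega> \<times> {0..T}) g" "0 < T"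
    and eq: "\<And>z. z \<in> \<Omega> \<times> {0..<T} \<Longrightarrow> g z = f z" and z: "z \<in> \<Omega> \<times> {0..T}"
  shows "g z = f z"
proof -
  obtain x t where xt: "z = (x, t)" "x \<in> \<Omega>" "t \<in> {0..T}" using z by (cases z) auto
  have slice: "continuous_on {0..T} (\<lambda>t. q (x, t))" if "continuous_on (\<Omega> \<times> {0..T}) q"
    for q :: "'a \<times> real \<Rightarrow> 'b"
    by (rule continuous_on_compose2[OF that]) (use xt in \<open>auto intro!: continuous_intros\<close>)
  have cl: "closure {0..<T} = {0..T}" using assms(3) by simp
  show ?thesis
  proof (cases "t < T")
    case False
    then have t: "t = T" using xt by simp
    have lim: "((\<lambda>t. q (x, t)) \<longlongrightarrow> q (x, T)) (at T within {0..<T})"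
      if "continuous_on (\<Omega> \<times> {0..T}) q" for q :: "'a \<times> real \<Rightarrow> 'b"
    proof (rule tendsto_within_subset)
      show "((\<lambda>t. q (x, t)) \<longlongrightarrow> q (x, T)) (at T within {0..T})"
        using slice[OF that] assms(3) by (simp add: continuous_on_def)
    qed auto
    have "\<forall>\<^sub>F s in at T within {0..<T}. g (x, s) = f (x, s)"
      using eq xt(2) by (auto simp: eventually_at_filter)
    then have "((\<lambda>t. f (x, t)) \<longlongrightarrow> g (x, T)) (at T within {0..<T})"
      by (rule Lim_transform_eventually[OF lim[OF assms(2)]])
    moreover have "at T within {0..<T} \<noteq> bot"
      using assms(3) by (simp add: at_within_eq_bot_iff cl)
    ultimately have "g (x, T) = f (x, T)"
      using lim[OF assms(1)] by (metis tendsto_unique)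
    then show ?thesis by (simp only: xt(1) t)
  qed (use eq xt in auto)
qed

lemma visc_solution_exists:
  fixes \<Omega> \<Gamma> :: "'a::euclidean_space set"
  assumes T: "0 < T" and \<Omega>: "compact \<Omega>" "\<Omega> \<noteq> {}" and \<Gamma>: "\<Gamma> \<subseteq> \<Omega>" "closed \<Gamma>" and op: "open (\<Omega> - \<Gamma>)"
    and P: "\<And>x. x \<in> \<Omega> - \<Gamma> \<Longrightarrow> 0 \<le> P x" "L-lipschitz_on (\<Omega> - \<Gamma>) P"
    and M: "\<And>x. x \<in> \<Omega> - \<Gamma> \<Longrightarrow> P x \<le> M" "0 \<le> M"
    and \<psi>: "l-lipschitz_on \<Omega> \<psi>"
    and \<psi>\<^sub>b: "continuous_on \<Omega> \<psi>\<^sub>b" "\<And>x. x \<in> \<Gamma> \<Longrightarrow> \<psi>\<^sub>b x = \<psi> x"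
    and \<psi>\<^sub>b_sub: "visc_subsolution \<Omega> \<Gamma> T P \<psi> (\<lambda>(x, t). \<psi>\<^sub>b x)"
  obtains f fbar where
    "continuous_on (\<Omega> \<times> {0..T}) f"
    "visc_subsolution_interior \<Omega> \<Gamma> T P f" "visc_supersolution_interior \<Omega> \<Gamma> T P f"
    "\<And>z. z \<in> parabolic_boundary \<Omega> \<Gamma> T \<Longrightarrow> f z = \<psi> (fst z)"
    "(max l M)-lipschitz_on (\<Omega> \<times> {0..T}) fbar"
    "\<And>x t. x \<in> \<Omega> \<Longrightarrow> t \<in> {0..T} \<Longrightarrow> \<psi>\<^sub>b x \<le> f (x, t) \<and> f (x, t) \<le> fbar (x, t)"
proof -
  \<comment> \<open>otherwise \<open>\<Omega>\<close> would be open and closed, hence the whole space, which is unbounded\<close>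
  have "\<Gamma> \<noteq> {}"
  proof
    assume "\<Gamma> = {}"
    then have "\<Omega> = UNIV" using clopen[of \<Omega>] op \<Omega> compact_imp_closed by auto
    then show False using \<Omega>(1) not_bounded_UNIV compact_imp_bounded by blast
  qed
  moreover have "compact \<Gamma>"
    using \<Omega>(1) \<Gamma> by (metis compact_Int_closed inf.absorb_iff2)
  ultimately have \<Gamma>': "compact \<Gamma>" "\<Gamma> \<noteq> {}" by simp_all
  define C where "C = max l M"
  have lipC: "C-lipschitz_on \<Omega> \<psi>" using \<psi> by (rule lipschitz_on_mono) (auto simp: C_def)
  have lip\<Gamma>: "C-lipschitz_on \<Gamma> \<psi>" using lipC \<Gamma>(1) by (rule lipschitz_on_subset)
  define b where "b = lip_upper_extension \<Gamma> \<psi> C"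
  have b_ge: "\<psi> x \<le> b x" if "x \<in> \<Omega>" for x
    unfolding b_def by (rule le_lip_upper_extension[OF \<Gamma>' lip\<Gamma> lipC \<Gamma>(1) that])
  have b_eq: "b x = \<psi> x" if "x \<in> \<Gamma>" for x
    unfolding b_def by (rule lip_upper_extension_eq[OF \<Gamma>' lip\<Gamma> that])
  have b_lip: "C-lipschitz_on S (\<lambda>z. b (fst z))" for S :: "('a \<times> real) set"
  proof (rule lipschitz_onI[OF _ lipschitz_on_nonneg[OF lipC]])
    fix z w :: "'a \<times> real"
    have "dist (b (fst z)) (b (fst w)) \<le> C * dist (fst z) (fst w)"
      unfolding b_def
      using lipschitz_onD[OF lipschitz_on_lip_upper_extension[OF \<Gamma>' lip\<Gamma>, of UNIV]] by blast
    also have "\<dots> \<le> C * dist z w"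
      using lipschitz_on_nonneg[OF lipC] dist_fst_le[of z w] by (intro mult_left_mono) auto
    finally show "dist (b (fst z)) (b (fst w)) \<le> C * dist z w" .
  qed
  have \<psi>\<^sub>b_le: "\<psi>\<^sub>b x \<le> \<psi> x" if "x \<in> \<Omega>" for x
  proof -
    have "(x, 0) \<in> parabolic_boundary \<Omega> \<Gamma> T" using that by (simp add: parabolic_boundary_def)
    moreover have "\<forall>(x, t)\<in>parabolic_boundary \<Omega> \<Gamma> T. (\<lambda>(x, t). \<psi>\<^sub>b x) (x, t) \<le> \<psi> x"
      using \<psi>\<^sub>b_sub unfolding visc_subsolution_def by blast
    ultimately show ?thesis by fastforce
  qed

  \<comment> \<open>any longer time interval will do, since continuity can fail only at its end\<close>
  define T' where "T' = T + 1"
  have T': "0 < T'" "T < T'" using T by (auto simp: T'_def)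
  define k where "k z = max (\<psi>\<^sub>b (fst z)) (\<psi> (fst z) - l * snd z)" for z
  define h where "h z = min (b (fst z)) (\<psi> (fst z) + M * snd z)" for z
  have cont_fst: "continuous_on (\<Omega> \<times> {0..T'}) (\<lambda>z. q (fst z))" if "continuous_on \<Omega> q"
    for q :: "'a \<Rightarrow> real"
    by (rule continuous_on_compose2[OF that]) (auto intro!: continuous_intros)
  have cont_\<psi>: "continuous_on \<Omega> \<psi>" using \<psi> by (rule lipschitz_on_continuous_on)
  have k_cont: "continuous_on (\<Omega> \<times> {0..T'}) k"
    unfolding k_def[abs_def] using \<psi>\<^sub>b(1) cont_\<psi> by (intro continuous_intros cont_fst)
  have h_cont: "continuous_on (\<Omega> \<times> {0..T'}) h"
    unfolding h_def[abs_def] using lipschitz_on_continuous_on[OF b_lip] cont_fst[OF cont_\<psi>]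
    by (intro continuous_intros)
  have k_sub: "visc_subsolution_interior \<Omega> \<Gamma> T' P k"
  proof -
    have "visc_subsolution_interior \<Omega> \<Gamma> T P (\<lambda>(x, t). \<psi>\<^sub>b x)"
      using \<psi>\<^sub>b_sub unfolding visc_subsolution_def by blast
    from stationary_visc_subsolution_interior_time[OF this \<psi>\<^sub>b(1) op T T'(1)]
    have "visc_subsolution_interior \<Omega> \<Gamma> T' P (\<lambda>z. \<psi>\<^sub>b (fst z))" by (simp add: case_prod_beta')
    then show ?thesis
      unfolding k_def[abs_def]
      using visc_subsolution_interior_decay[OF op \<psi> P(1)] by (rule visc_subsolution_interior_max)
  qed
  have h_super: "visc_supersolution_interior \<Omega> \<Gamma> T' P h"
  proof -
    have "P x \<le> C" if "x \<in> \<Omega> - \<Gamma>" for x using M(1)[OF that] by (simp add: C_def)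
    from lip_upper_extension_visc_supersolution_interior[OF \<Gamma>' lip\<Gamma> op this]
    have "visc_supersolution_interior \<Omega> \<Gamma> T' P (\<lambda>z. b (fst z))" by (simp add: b_def)
    then show ?thesis
      unfolding h_def[abs_def]
      using visc_supersolution_interior_growth[OF op cont_\<psi> M(1)]
      by (rule visc_supersolution_interior_min)
  qed
  have between: "k z \<le> \<psi> (fst z) \<and> \<psi> (fst z) \<le> h z" if "z \<in> \<Omega> \<times> {0..T'}" for z
    using that \<psi>\<^sub>b_le[of "fst z"] b_ge[of "fst z"] M(2) lipschitz_on_nonneg[OF \<psi>]
    by (auto simp: k_def h_def mem_Times_iff)
  have PK: "z \<in> \<Omega> \<times> {0..T'}" if "z \<in> parabolic_boundary \<Omega> \<Gamma> T'" for z
    using that \<Gamma>(1) T' by (auto simp: parabolic_boundary_def)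
  have k_bd: "k z = \<psi> (fst z)" and h_bd: "h z = \<psi> (fst z)" if z: "z \<in> parabolic_boundary \<Omega> \<Gamma> T'" for z
  proof -
    have "\<psi> (fst z) \<le> k z \<and> h z \<le> \<psi> (fst z)"
      using z \<psi>\<^sub>b(2) b_eq by (auto simp: parabolic_boundary_def k_def h_def)
    then show "k z = \<psi> (fst z)" "h z = \<psi> (fst z)" using between[OF PK[OF z]] by auto
  qed
  obtain f g where f: "visc_subsolution_interior \<Omega> \<Gamma> T' P f"
    and g: "visc_supersolution_interior \<Omega> \<Gamma> T' P g"
    and fg: "\<And>z. z \<in> \<Omega> \<times> {0..<T'} \<Longrightarrow> f z = g z"
    and kfh: "\<And>z. z \<in> \<Omega> \<times> {0..T'} \<Longrightarrow> k z \<le> f z \<and> f z \<le> h z"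
  proof (rule visc_perron[OF \<Omega>(1) op P(2) k_sub k_cont h_super h_cont _ _ \<Gamma>(1) T'(1)])
    show "k z \<le> h z" if "z \<in> \<Omega> \<times> {0..T'}" for z using between[OF that] by linarith
    show "k z = h z" if "z \<in> parabolic_boundary \<Omega> \<Gamma> T'" for z using k_bd h_bd that by simp
  qed blast
  have sub: "visc_subsolution_interior \<Omega> \<Gamma> T P f"
    using visc_subsolution_interior_restrict[OF f] T' by simp
  have eq: "g z = f z" if "z \<in> \<Omega> \<times> {0..T}" for z using that T' by (intro fg[symmetric]) auto
  have "visc_supersolution_interior \<Omega> \<Gamma> T P g"
    using visc_supersolution_interior_restrict[OF g] T' by simp
  with eq have super: "visc_supersolution_interior \<Omega> \<Gamma> T P f"
    by (rule visc_supersolution_interior_cong)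
  show ?thesis
  proof (rule that)
    show "continuous_on (\<Omega> \<times> {0..T}) f"
      using visc_subsolution_interior_usc[OF sub] visc_supersolution_interior_lsc[OF super]
      by (simp add: continuous_on_iff_usc_lsc)
    show "f z = \<psi> (fst z)" if "z \<in> parabolic_boundary \<Omega> \<Gamma> T" for z
    proof -
      have z: "z \<in> parabolic_boundary \<Omega> \<Gamma> T'"
        using that T' by (auto simp: parabolic_boundary_def)
      then show ?thesis using kfh[OF PK[OF z]] k_bd h_bd by simp
    qed
    show "(max l M)-lipschitz_on (\<Omega> \<times> {0..T}) (\<lambda>z. b (fst z))"
      using b_lip unfolding C_def .
    show "\<psi>\<^sub>b x \<le> f (x, t) \<and> f (x, t) \<le> b (fst (x, t))" if "x \<in> \<Omega>" "t \<in> {0..T}" for x t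
      using kfh[of "(x, t)"] that T' by (simp add: k_def h_def)
  qed (fact sub super)+
qed

theorem proposition2p5:
  shows "\<exists>K :: real \<Rightarrow> real \<Rightarrow> real \<Rightarrow> real \<Rightarrow> real.
    \<forall>(T :: real) (\<Omega> :: (real ^ 'm) set) \<Gamma> P \<psi> a\<^sub>0 d\<^sub>0 \<psi>\<^sub>b.
      T > 0 \<longrightarrow>
      compact \<Omega> \<longrightarrow>
      \<Gamma> \<subseteq> \<Omega> \<longrightarrow> closed \<Gamma> \<longrightarrow> open (\<Omega> - \<Gamma>) \<longrightarrow>
      (\<forall>x\<in>\<Omega> - \<Gamma>. P x \<ge> 0) \<longrightarrow>
      (\<exists>L. L-lipschitz_on (\<Omega> - \<Gamma>) P) \<longrightarrow>
      (\<exists>L. L-lipschitz_on \<Omega> \<psi>) \<longrightarrow>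
      a\<^sub>0 > 0 \<longrightarrow> d\<^sub>0 > 0 \<longrightarrow>
      (\<exists>G. C1_with_gradient_on ({x\<in>\<Omega>. infdist x \<Gamma> < a\<^sub>0} - \<Gamma>) (\<lambda>x. infdist x \<Gamma>) G \<and>
           (\<forall>x\<in>{x\<in>\<Omega>. infdist x \<Gamma> < a\<^sub>0} - \<Gamma>. norm (G x) \<ge> d\<^sub>0)) \<longrightarrow>
      (\<exists>L. L-lipschitz_on \<Omega> \<psi>\<^sub>b) \<longrightarrow>
      (\<forall>x\<in>\<Gamma>. \<psi>\<^sub>b x = \<psi> x) \<longrightarrow>
      visc_subsolution \<Omega> \<Gamma> T P \<psi> (\<lambda>(x, t). \<psi>\<^sub>b x) \<longrightarrow>
      (\<exists>f. visc_solution \<Omega> \<Gamma> T P \<psi> f \<and>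
           continuous_on (\<Omega> \<times> {0..T}) f \<and>
           (\<forall>g. visc_solution \<Omega> \<Gamma> T P \<psi> g \<longrightarrow> (\<forall>z\<in>\<Omega> \<times> {0..<T}. g z = f z)) \<and>
           (\<forall>g. visc_solution \<Omega> \<Gamma> T P \<psi> g \<longrightarrow> continuous_on (\<Omega> \<times> {0..T}) g \<longrightarrow>
                (\<forall>z\<in>\<Omega> \<times> {0..T}. g z = f z)) \<and>
           (\<exists>fbar.
              (K a\<^sub>0 d\<^sub>0 (lip_const \<Omega> \<psi>) (sup_norm_on (\<Omega> - \<Gamma>) P))-lipschitz_on (\<Omega> \<times> {0..T}) fbar \<and>
              (\<forall>x\<in>\<Omega>. \<forall>t\<in>{0..T}. \<psi>\<^sub>b x \<le> f (x, t) \<and> f (x, t) \<le> fbar (x, t))))"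
proof (intro exI[of _ "\<lambda>a d l M. max l M"] allI impI)
  \<comment> \<open>the slope of the Lipschitz majorant must dominate both the slope of \<open>\<psi>\<close> and the running cost \<open>P\<close>\<close>
  fix T :: real and \<Omega> \<Gamma> :: "(real ^ 'm) set" and P \<psi> \<psi>\<^sub>b :: "real ^ 'm \<Rightarrow> real"
  assume T: "0 < T" and \<Omega>: "compact \<Omega>" and \<Gamma>: "\<Gamma> \<subseteq> \<Omega>" "closed \<Gamma>" and op: "open (\<Omega> - \<Gamma>)"
    and P0: "\<forall>x\<in>\<Omega> - \<Gamma>. P x \<ge> 0" and P_lip: "\<exists>L. L-lipschitz_on (\<Omega> - \<Gamma>) P"
    and \<psi>_lip: "\<exists>L. L-lipschitz_on \<Omega> \<psi>" and \<psi>\<^sub>b_lip: "\<exists>L. L-lipschitz_on \<Omega> \<psi>\<^sub>b"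
    and \<psi>\<^sub>b_eq: "\<forall>x\<in>\<Gamma>. \<psi>\<^sub>b x = \<psi> x" and \<psi>\<^sub>b_sub: "visc_subsolution \<Omega> \<Gamma> T P \<psi> (\<lambda>(x, t). \<psi>\<^sub>b x)"
  let ?l = "lip_const \<Omega> \<psi>" and ?M = "sup_norm_on (\<Omega> - \<Gamma>) P"
  obtain L where L: "L-lipschitz_on (\<Omega> - \<Gamma>) P" using P_lip by blast
  have l: "?l-lipschitz_on \<Omega> \<psi>" using \<psi>_lip lipschitz_on_lip_const by blast
  have "bounded (\<Omega> - \<Gamma>)" using \<Omega> by (auto intro: bounded_subset compact_imp_bounded)
  then have bounded: "bounded (P ` (\<Omega> - \<Gamma>))"
    using L lipschitz_on_uniformly_continuous bounded_uniformly_continuous_image by blast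
  have M: "P x \<le> ?M" if "x \<in> \<Omega> - \<Gamma>" for x using abs_le_sup_norm_on[OF bounded that] by simp
  have M0: "0 \<le> ?M" by (rule sup_norm_on_nonneg[OF bounded])
  have \<psi>\<^sub>b_cont: "continuous_on \<Omega> \<psi>\<^sub>b" using \<psi>\<^sub>b_lip lipschitz_on_continuous_on by blast
  obtain f fbar where f: "continuous_on (\<Omega> \<times> {0..T}) f"
    "visc_subsolution_interior \<Omega> \<Gamma> T P f" "visc_supersolution_interior \<Omega> \<Gamma> T P f"
    "\<And>z. z \<in> parabolic_boundary \<Omega> \<Gamma> T \<Longrightarrow> f z = \<psi> (fst z)"
    and fbar: "(max ?l ?M)-lipschitz_on (\<Omega> \<times> {0..T}) fbar"
    "\<And>x t. x \<in> \<Omega> \<Longrightarrow> t \<in> {0..T} \<Longrightarrow> \<psi>\<^sub>b x \<le> f (x, t) \<and> f (x, t) \<le> fbar (x, t)"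
  proof (cases "\<Omega> = {}")
    case True
    then have "\<Gamma> = {}" using \<Gamma>(1) by simp
    then show ?thesis
      using True M0
      by (intro that[of "\<lambda>_. 0" "\<lambda>_. 0"])
        (simp_all add: visc_subsolution_interior_def visc_supersolution_interior_def usc_on_def
          lsc_on_def local_max_on_def local_min_on_def parabolic_boundary_def lipschitz_on_def)
  next
    case False
    have P_nonneg: "0 \<le> P x" if "x \<in> \<Omega> - \<Gamma>" for x using P0 that by blast
    have \<psi>\<^sub>b_\<Gamma>: "\<psi>\<^sub>b x = \<psi> x" if "x \<in> \<Gamma>" for x using \<psi>\<^sub>b_eq that by blast
    show ?thesis
      by (rule visc_solution_exists[OF T \<Omega> False \<Gamma> op P_nonneg L M M0 l \<psi>\<^sub>b_cont \<psi>\<^sub>b_\<Gamma> \<psi>\<^sub>b_sub])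
        (assumption+, rule that)
  qed
  have unique: "g z = f z" if "visc_solution \<Omega> \<Gamma> T P \<psi> g" "z \<in> \<Omega> \<times> {0..<T}" for g z
    using visc_solution_unique[OF \<Omega> op L f(2-4) that] .
  show "\<exists>f. visc_solution \<Omega> \<Gamma> T P \<psi> f \<and>
           continuous_on (\<Omega> \<times> {0..T}) f \<and>
           (\<forall>g. visc_solution \<Omega> \<Gamma> T P \<psi> g \<longrightarrow> (\<forall>z\<in>\<Omega> \<times> {0..<T}. g z = f z)) \<and>
           (\<forall>g. visc_solution \<Omega> \<Gamma> T P \<psi> g \<longrightarrow> continuous_on (\<Omega> \<times> {0..T}) g \<longrightarrow>
                (\<forall>z\<in>\<Omega> \<times> {0..T}. g z = f z)) \<and>
           (\<exists>fbar. (max ?l ?M)-lipschitz_on (\<Omega> \<times> {0..T}) fbar \<and>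
              (\<forall>x\<in>\<Omega>. \<forall>t\<in>{0..T}. \<psi>\<^sub>b x \<le> f (x, t) \<and> f (x, t) \<le> fbar (x, t)))"
  proof (rule exI[of _ f], intro conjI allI impI ballI)
    show "visc_solution \<Omega> \<Gamma> T P \<psi> f" by (rule visc_solution_of_continuous[OF f(1) \<Omega> T \<Gamma>(1) f(2-4)])
    show "g z = f z" if "visc_solution \<Omega> \<Gamma> T P \<psi> g" "continuous_on (\<Omega> \<times> {0..T}) g"
      "z \<in> \<Omega> \<times> {0..T}" for g z
      using continuous_on_eq_at_final_time[OF f(1) that(2) T unique[OF that(1)] that(3)] .
    show "\<exists>fbar. (max ?l ?M)-lipschitz_on (\<Omega> \<times> {0..T}) fbar \<and>
        (\<forall>x\<in>\<Omega>. \<forall>t\<in>{0..T}. \<psi>\<^sub>b x \<le> f (x, t) \<and> f (x, t) \<le> fbar (x, t))"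
      using fbar by blast
  qed (fact f(1), rule unique)
qed

end
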